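(* Let $\rho\in[0,1)$, $\theta\in[0,1]$, $\sigma\in\mathbb{R}$, $T>0$ and $\lambda>0$ be fixed with $$\lambda\left[1-2\left(\theta-\rho\sigma-\rho^2\right)\right]<1 .$$ For $N\in\mathbb{N}$ let $k=T/N$ and $h=\sqrt{k/\lambda}$, so that $k/h^2=\lambda$ is kept fixed. Then the $\theta$-$\sigma$ Milstein central difference scheme with Dirac initial data converges in the mean-square sense for the spatial $L_2$- and $L_\infty$-norms, and, for $\|\cdot\|$ either of these two norms, $$\sqrt{\mathbb{E}\left[\|V^N - v(T,\cdot)\|^2\right]} = O(k)\qquad\text{as } N\to\infty,$$ where $V^N=(V_j^N)_{j\in\mathbb{Z}}$ is the numerical solution after $N$ time steps and $v$ is the exact solution of the SPDE with Dirac initial data.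
   Context: The SPDE is $\mathrm{d}v = \frac12 \frac{\partial^2 v}{\partial x^2}\,\mathrm{d}t - \sqrt{\rho}\,\frac{\partial v}{\partial x}\,\mathrm{d}M_t$ on $\mathbb{R}$ (zero first-order drift, $\mu=0$), with $M$ a one-dimensional standard Brownian motion and $v(0,\cdot)=\delta_0$, the Dirac mass at $0$. Its solution for $t>0$ is $$v(t,x)=\frac{1}{\sqrt{2\pi(1-\rho)t}}\exp\left(-\frac{(x-\sqrt{\rho}\,M_t)^2}{2(1-\rho)t}\right).$$ For a sequence $V=(V_j)_{j\in\mathbb{Z}}$ put $(D_1V)_j = V_{j+1}-V_{j-1}$ and $(D_2V)_j = V_{j+1}-2V_j+V_{j-1}$. Let $t_n=nk$ and let $Z_n$ be defined by $M_{t_{n+1}}-M_{t_n}=\sqrt{k}\,Z_n$, so the $Z_n$ are independent $N(0,1)$ and the scheme is driven by the same Brownian path as $v$. The $\theta$-$\sigma$ Milstein central difference scheme for $V^n=(V_j^n)_{j\in\mathbb{Z}}\in\ell^2(\mathbb{Z})$, $0\le n\le N$, is $$V^{n+1} = V^n + \theta\frac{k}{2h^2}D_2V^{n+1} + (1-\theta)\frac{k}{2h^2}D_2V^n - \sigma\frac{\rho k}{2h^2}D_2V^{n+1} - (1-\sigma)\frac{\rho k}{2h^2}D_2V^n - \frac{\sqrt{\rho k}\,Z_n}{2h}D_1V^n + \frac{\rho k Z_n^2}{2h^2}D_2V^n .$$ The discrete Dirac initial data are $V_0^0=1/h$ and $V_j^0=0$ for $j\ne0$; equivalently $V_j^0=\frac1{2\pi}\int_{-\pi/h}^{\pi/h}e^{i\kappa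 hj}\,\mathrm{d}\kappa$. The spatial norms are taken on the grid $\{jh: j\in\mathbb{Z}\}$: $\|V^N-v(T,\cdot)\|_{L_2}^2 = h\sum_{j\in\mathbb{Z}}|V_j^N-v(T,jh)|^2$ and $\|V^N-v(T,\cdot)\|_{L_\infty}=\sup_{j\in\mathbb{Z}}|V_j^N-v(T,jh)|$. *)

theory Defs
  imports "HOL-Probability.Probability" "HOL-Library.Landau_Symbols"
begin

locale standard_brownian_motion = prob_space M
  for M :: "'a measure" and B :: "real \<Rightarrow> 'a \<Rightarrow> real" +
  assumes BM_measurable: "\<And>t. 0 \<le> t \<Longrightarrow> B t \<in> borel_measurable M"
    and BM_zero: "AE \<omega> in M. B 0 \<omega> = 0"
    and BM_indep_increments:
      "\<And>(t :: nat \<Rightarrow> real) n. 0 \<le> t 0 \<Longrightarrow> (\<And>i. i < n \<Longrightarrow> t i < t (Suc i)) \<Longrightarrow>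
         indep_vars (\<lambda>_. borel) (\<lambda>i \<omega>. B (t (Suc i)) \<omega> - B (t i) \<omega>) {..<n}"
    and BM_normal_increments:
      "\<And>s t. 0 \<le> s \<Longrightarrow> s < t \<Longrightarrow>
         distributed M lborel (\<lambda>\<omega>. B t \<omega> - B s \<omega>) (normal_density 0 (sqrt (t - s)))"
    and BM_continuous: "AE \<omega> in M. continuous_on {0..} (\<lambda>t. B t \<omega>)"

text \<open>The solution at time \<open>t > 0\<close> and position \<open>x\<close> of
  \<open>dv = 1/2 v_xx dt - sqrt \<rho> v_x dM_t\<close> with \<open>v(0, \<cdot>) = \<delta>_0\<close>, in closed form;
  \<open>m\<close> is the value \<open>M_t\<close> of the driving Brownian path.\<close>

definition spde_solution :: "real \<Rightarrow> real \<Rightarrow> real \<Rightarrow> real \<Rightarrow> real" where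
  "spde_solution \<rho> m t x =
     1 / sqrt (2 * pi * (1 - \<rho>) * t) * exp (- ((x - sqrt \<rho> * m)\<^sup>2 / (2 * (1 - \<rho>) * t)))"

definition D1 :: "(int \<Rightarrow> real) \<Rightarrow> int \<Rightarrow> real" where
  "D1 V j = V (j + 1) - V (j - 1)"

definition D2 :: "(int \<Rightarrow> real) \<Rightarrow> int \<Rightarrow> real" where
  "D2 V j = V (j + 1) - 2 * V j + V (j - 1)"

definition in_ell2 :: "(int \<Rightarrow> real) \<Rightarrow> bool" where
  "in_ell2 V \<longleftrightarrow> (\<lambda>j. (V j)\<^sup>2) summable_on UNIV"

text \<open>One step \<open>V \<mapsto> W\<close> of the \<open>\<theta>\<close>-\<open>\<sigma>\<close> Milstein scheme with time step \<open>k\<close>, mesh size \<open>h\<close> and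
  normalised Brownian increment \<open>z\<close>; it is implicit in \<open>W\<close>.\<close>

definition milstein_step ::
  "real \<Rightarrow> real \<Rightarrow> real \<Rightarrow> real \<Rightarrow> real \<Rightarrow> real \<Rightarrow> (int \<Rightarrow> real) \<Rightarrow> (int \<Rightarrow> real) \<Rightarrow> bool" where
  "milstein_step \<rho> \<theta> \<sigma> k h z V W \<longleftrightarrow>
     (\<forall>j. W j = V j
        + \<theta> * (k / (2 * h\<^sup>2)) * D2 W j + (1 - \<theta>) * (k / (2 * h\<^sup>2)) * D2 V j
        - \<sigma> * (\<rho> * k / (2 * h\<^sup>2)) * D2 W j - (1 - \<sigma>) * (\<rho> * k / (2 * h\<^sup>2)) * D2 V j
        - sqrt (\<rho> * k) * z / (2 * h) * D1 V j
        + \<rho> * k * z\<^sup>2 / (2 * h\<^sup>2) * D2 V j)"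

definition dirac_data :: "real \<Rightarrow> int \<Rightarrow> real" where
  "dirac_data h j = (if j = 0 then 1 / h else 0)"

definition milstein_scheme ::
  "real \<Rightarrow> real \<Rightarrow> real \<Rightarrow> real \<Rightarrow> real \<Rightarrow> nat \<Rightarrow> (nat \<Rightarrow> real) \<Rightarrow> (nat \<Rightarrow> int \<Rightarrow> real) \<Rightarrow> bool" where
  "milstein_scheme \<rho> \<theta> \<sigma> k h N Z V \<longleftrightarrow>
     V 0 = dirac_data h \<and>
     (\<forall>n\<le>N. in_ell2 (V n)) \<and>
     (\<forall>n<N. milstein_step \<rho> \<theta> \<sigma> k h (Z n) (V n) (V (Suc n)))"

definition normalized_increment :: "(real \<Rightarrow> 'a \<Rightarrow> real) \<Rightarrow> real \<Rightarrow> 'a \<Rightarrow> nat \<Rightarrow> real" where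
  "normalized_increment B k \<omega> n = (B (real (Suc n) * k) \<omega> - B (real n * k) \<omega>) / sqrt k"

text \<open>Squared grid norms are taken in \<open>[0, \<infinity>]\<close>, so that divergent sums, unbounded
  sequences and infinite expectations have the value \<open>\<infinity>\<close> rather than a default real value.\<close>

definition grid_L2_norm_sq :: "real \<Rightarrow> (int \<Rightarrow> real) \<Rightarrow> ennreal" where
  "grid_L2_norm_sq h u = ennreal h * (\<Sum>\<^sub>\<infinity>j. ennreal (\<bar>u j\<bar>\<^sup>2))"

definition grid_Linf_norm_sq :: "(int \<Rightarrow> real) \<Rightarrow> ennreal" where
  "grid_Linf_norm_sq u = (SUP j. ennreal \<bar>u j\<bar>)\<^sup>2"

definition mean_square :: "'a measure \<Rightarrow> ((int \<Rightarrow> real) \<Rightarrow> ennreal) \<Rightarrow> ('a \<Rightarrow> int \<Rightarrow> real) \<Rightarrow> ennreal" where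
  "mean_square M norm_sq u = (\<integral>\<^sup>+ \<omega>. norm_sq (u \<omega>) \<partial>M)"

text \<open>Meaningful when the mean square is finite (\<open>enn2real \<infinity> = 0\<close>).\<close>

definition root_mean_square :: "'a measure \<Rightarrow> ((int \<Rightarrow> real) \<Rightarrow> ennreal) \<Rightarrow> ('a \<Rightarrow> int \<Rightarrow> real) \<Rightarrow> real" where
  "root_mean_square M norm_sq u = sqrt (enn2real (mean_square M norm_sq u))"

end

theory Submission
  imports Defs "HOL-Real_Asymp.Real_Asymp"
begin

text \<open>In Fourier space a step of the scheme multiplies the coefficient at wave number
  \<open>x = \<kappa>h\<close> by a random factor \<open>C(x, Z\<^sub>n)\<close>, and a step of the exact solution multiplies it by
  \<open>S(x, Z\<^sub>n) = exp (- \<i> u x Z\<^sub>n - (1 - \<rho>) \<lambda> x\<^sup>2 / 2)\<close>, where \<open>u = sqrt (\<rho> \<lambda>)\<close>. As the \<open>Z\<^sub>n\<close> are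
  independent, the mean square of \<open>\<Prod>C - \<Prod>S\<close> over \<open>N\<close> steps is \<open>A^N - 2 B^N + F^N\<close> with
  \<open>A = E \<bar>C\<bar>\<^sup>2\<close>, \<open>B = E (cnj C S)\<close>, \<open>F = \<bar>S\<bar>\<^sup>2\<close>. The stability condition says that \<open>A < 1\<close> away
  from \<open>x = 0\<close>, so all three are at most \<open>exp (- c x\<^sup>2)\<close> for \<open>\<bar>x\<bar> \<le> \<pi>\<close>; moreover \<open>A - B\<close> and
  \<open>F - B\<close> are \<open>O(x\<^sup>4)\<close>, and \<open>A - 2 B + F = E \<bar>C - S\<bar>\<^sup>2\<close> is \<open>O(x\<^sup>6)\<close>. Hence
  \<open>A^N - 2 B^N + F^N \<le> K / N\<^sup>2 exp (- c N x\<^sup>2)\<close>.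

  The exact solution has frequencies outside \<open>[- \<pi>, \<pi>]\<close>. Instead of aliasing and Parseval's
  identity, a dual large sieve inequality with Gaussian weight bounds the \<open>L\<^sub>2\<close> grid norm of the
  error by \<open>\<integral>\<bar>g\<bar>\<^sup>2 exp (x\<^sup>2 / 2)\<close> over the whole line, where \<open>g\<close> is the difference of the Fourier
  transforms; the sup norm is bounded by Cauchy--Schwarz with the weight \<open>exp (d N x\<^sup>2)\<close>.
  Integrating the bound above gives \<open>N powr (- 5/2)\<close>, and the powers of \<open>h\<close> in front turn this
  into \<open>1 / N\<^sup>2\<close> for both norms.\<close>

section \<open>Analytic preliminaries\<close>

text \<open>A single term of the exponential series is at most its sum. This turns powers of
  \<open>N x^2\<close> into constants at the price of part of a Gaussian exponent.\<close>

lemma power_le_exp: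
  fixes c :: real
  assumes "0 < c"
  obtains K where "0 < K" "\<And>y. 0 \<le> y \<Longrightarrow> y ^ m \<le> K * exp (c * y)"
proof
  show "0 < fact m / c ^ m" using assms by simp
  fix y :: real assume y: "0 \<le> y"
  have "(c * y) ^ m / fact m \<le> (\<Sum>i\<in>{m}. (c * y) ^ i /\<^sub>R fact i)"
    by (simp add: field_simps)
  also have "\<dots> \<le> (\<Sum>i. (c * y) ^ i /\<^sub>R fact i)"
    using assms y by (intro sum_le_suminf summable_exp_generic) auto
  also have "\<dots> = exp (c * y)" by (simp add: exp_def)
  finally show "y ^ m \<le> fact m / c ^ m * exp (c * y)"
    using assms by (simp add: field_simps)
qed

text \<open>The Landau bound holds on a punctured neighbourhood of 0; on the rest of the interval,
  which is compact, \<open>f / g\<close> is continuous and hence bounded. The filter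
  \<open>at 0\<close> says nothing about the point 0 itself, hence the hypothesis
  \<open>f 0 = 0\<close>.\<close>

lemma bigo_at_0_uniform:
  fixes f g :: "real \<Rightarrow> real"
  assumes fg: "f \<in> O[at 0](g)"
    and nz: "\<And>x. x \<in> {-R..R} \<Longrightarrow> x \<noteq> 0 \<Longrightarrow> g x \<noteq> 0"
    and f0: "f 0 = 0"
    and f: "continuous_on {-R..R} f" and g: "continuous_on {-R..R} g"
  obtains K where "0 < K" "\<And>x. \<bar>x\<bar> \<le> R \<Longrightarrow> \<bar>f x\<bar> \<le> K * \<bar>g x\<bar>"
proof -
  obtain c where c: "0 < c" "\<forall>\<^sub>F x in at 0. norm (f x) \<le> c * norm (g x)"
    using fg by (elim landau_o.bigE)
  then obtain d where d: "0 < d" "\<And>x. x \<noteq> 0 \<Longrightarrow> \<bar>x\<bar> < d \<Longrightarrow> \<bar>f x\<bar> \<le> c * \<bar>g x\<bar>"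
    by (auto simp: eventually_at dist_real_def)
  define S where "S = {-R..R} \<inter> {x. d \<le> \<bar>x\<bar>}"
  have "compact S" unfolding S_def
    by (intro compact_Int_closed closed_Collect_le continuous_intros) auto
  moreover have "continuous_on S (\<lambda>x. f x / g x)"
    using d(1) nz by (intro continuous_on_divide continuous_on_subset[OF f] continuous_on_subset[OF g])
      (auto simp: S_def)
  ultimately have "bounded ((\<lambda>x. f x / g x) ` S)"
    by (intro compact_imp_bounded compact_continuous_image)
  then obtain b where b: "\<And>x. x \<in> S \<Longrightarrow> \<bar>f x / g x\<bar> \<le> b"
    by (auto simp: bounded_iff)
  show ?thesis
  proof
    show "0 < max c b" using c by simp
    fix x assume x: "\<bar>x\<bar> \<le> R"
    consider "x = 0" | "x \<noteq> 0" "\<bar>x\<bar> < d" | "x \<noteq> 0" "x \<in> S" using x by (force simp: S_def)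
    then show "\<bar>f x\<bar> \<le> max c b * \<bar>g x\<bar>"
    proof cases
      case 1 then show ?thesis using f0 c(1) by (auto intro!: mult_nonneg_nonneg)
    next
      case 2 then show ?thesis using d(2)[of x]
        by (meson abs_ge_zero max.cobounded1 mult_right_mono order_trans)
    next
      case 3
      then have "g x \<noteq> 0" using nz by (auto simp: S_def)
      moreover have "\<bar>f x / g x\<bar> \<le> max c b" using b[OF 3(2)] by simp
      ultimately show ?thesis by (simp add: field_simps)
    qed
  qed
qed

text \<open>Quadratic Taylor remainder of a power at \<open>b\<close>. In the induction the next
  remainder is \<open>a\<close> times the previous one plus
  \<open>(n + 2) b^(n+1) (a - b)^2\<close>, and the constant closes because
  \<open>m^2 + m <= (m + 1)^2\<close>.\<close>

lemma power_remainder_bound: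
  fixes a b \<mu> :: real
  assumes "\<bar>a\<bar> \<le> \<mu>" "\<bar>b\<bar> \<le> \<mu>"
  shows "\<bar>a ^ (n + 2) - b ^ (n + 2) - real (n + 2) * b ^ (n + 1) * (a - b)\<bar>
    \<le> (real (n + 2))\<^sup>2 * \<mu> ^ n * (a - b)\<^sup>2"
proof (induction n)
  case 0
  have "\<bar>(a - b)\<^sup>2\<bar> \<le> 4 * (a - b)\<^sup>2" by simp
  then show ?case by (simp add: power2_eq_square algebra_simps)
next
  case (Suc n)
  let ?R = "a ^ (n + 2) - b ^ (n + 2) - real (n + 2) * b ^ (n + 1) * (a - b)"
  have \<mu>: "0 \<le> \<mu>" using assms by linarith
  have "a ^ (Suc n + 2) - b ^ (Suc n + 2) - real (Suc n + 2) * b ^ (Suc n + 1) * (a - b)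
      = a * ?R + real (n + 2) * b ^ (n + 1) * (a - b)\<^sup>2"
    by (simp add: power2_eq_square algebra_simps)
  also have "\<bar>\<dots>\<bar> \<le> \<bar>a\<bar> * \<bar>?R\<bar> + real (n + 2) * \<bar>b\<bar> ^ (n + 1) * (a - b)\<^sup>2"
    by (rule order_trans[OF abs_triangle_ineq]) (simp add: abs_mult power_abs)
  also have "\<dots> \<le> \<mu> * ((real (n + 2))\<^sup>2 * \<mu> ^ n * (a - b)\<^sup>2) + real (n + 2) * \<mu> ^ (n + 1) * (a - b)\<^sup>2"
  proof (rule add_mono)
    show "\<bar>a\<bar> * \<bar>?R\<bar> \<le> \<mu> * ((real (n + 2))\<^sup>2 * \<mu> ^ n * (a - b)\<^sup>2)"
      using assms \<mu> by (intro mult_mono Suc.IH) auto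
    show "real (n + 2) * \<bar>b\<bar> ^ (n + 1) * (a - b)\<^sup>2 \<le> real (n + 2) * \<mu> ^ (n + 1) * (a - b)\<^sup>2"
      using assms by (intro mult_right_mono[OF mult_left_mono[OF power_mono]]) auto
  qed
  also have "\<dots> = ((real (n + 2))\<^sup>2 + real (n + 2)) * (\<mu> ^ Suc n * (a - b)\<^sup>2)"
    by (simp add: algebra_simps)
  also have "\<dots> \<le> (real (Suc n + 2))\<^sup>2 * (\<mu> ^ Suc n * (a - b)\<^sup>2)"
  proof (rule mult_right_mono)
    show "(real (n + 2))\<^sup>2 + real (n + 2) \<le> (real (Suc n + 2))\<^sup>2"
      by (simp add: power2_eq_square algebra_simps)
  qed (use \<mu> in simp)
  finally show ?case by (simp add: mult.assoc)
qed

section \<open>Second moments of the Fourier symbols\<close>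

text \<open>The parameters are \<open>l = k / h\<^sup>2\<close>, \<open>r = \<rho>\<close> and \<open>t = \<theta> - \<rho> * \<sigma>\<close>; the implicit parts of the scheme enter only
  through \<open>t\<close>.\<close>

locale milstein_symbol =
  fixes l r t :: real
  assumes l: "0 < l" and r: "0 \<le> r" "r < 1" and stable: "l * (1 - 2 * (t - r\<^sup>2)) < 1"
begin

text \<open>Symbol of the implicit operator \<open>W - (l t / 2) D2 W\<close>: at wave number
  \<open>x\<close>, \<open>D2\<close> multiplies by \<open>-2 (1 - cos x)\<close>.\<close>

definition den :: "real \<Rightarrow> real" where "den x = 1 + l * t * (1 - cos x)"

text \<open>With the one-step factors \<open>amp\<close> of the scheme and \<open>exact\<close> of the solution defined below,
  and \<open>z\<close> standard normal, these are closed forms of the mean of \<open>\<bar>amp\<bar>\<^sup>2\<close>, the mean of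
  \<open>cnj amp * exact\<close> (which is real), and \<open>\<bar>exact\<bar>\<^sup>2\<close>.\<close>

definition mean_sq_amp :: "real \<Rightarrow> real" where
  "mean_sq_amp x = ((den x - l * (1 - cos x))\<^sup>2 + 2 * (l * r * (1 - cos x))\<^sup>2 + r * l
      * (sin x)\<^sup>2) / (den x)\<^sup>2"

definition mean_cross :: "real \<Rightarrow> real" where
  "mean_cross x = exp (- (l * x\<^sup>2 / 2)) *
     (den x - l * (1 - cos x) + l * r * (1 - cos x) * (r * l * x\<^sup>2) + r * l * x * sin x) / den x"

definition sq_exact :: "real \<Rightarrow> real" where "sq_exact x = exp (- ((1 - r) * l * x\<^sup>2))"

text \<open>For negative \<open>t\<close> the minimum \<open>1 + 2 l t\<close> is attained at
  \<open>x = pi\<close>, and the stability condition gives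
  \<open>1 + 2 l t > l + 2 l r^2 > 0\<close>. So stability also makes the implicit step
  solvable.\<close>

lemma den_pos: "0 < den x"
proof (cases "0 \<le> t")
  case True
  then show ?thesis using l by (simp add: den_def add_pos_nonneg)
next
  case False
  have "l * t * (1 - cos x) \<ge> l * t * 2"
    using False l cos_ge_minus_one[of x] by (intro mult_left_mono_neg) (auto simp: mult_nonneg_nonpos)
  moreover have "l * (1 - 2 * (t - r\<^sup>2)) = l + 2 * l * r\<^sup>2 - l * t * 2" by (simp add: algebra_simps)
  moreover have "0 \<le> 2 * l * r\<^sup>2" using l by simp
  ultimately show ?thesis using stable l unfolding den_def by linarith
qed

lemma den_nz [simp]: "den x \<noteq> 0" using den_pos[of x] by simp

lemma continuous_den [continuous_intros]: "continuous_on S den"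
  unfolding den_def by (intro continuous_intros)

lemma continuous_moments:
  shows "continuous_on S mean_sq_amp" "continuous_on S mean_cross" "continuous_on S sq_exact"
  unfolding mean_sq_amp_def mean_cross_def sq_exact_def by (intro continuous_intros; simp)+

lemma moments_at_0 [simp]: "mean_sq_amp 0 = 1" "mean_cross 0 = 1" "sq_exact 0 = 1"
  by (simp_all add: mean_sq_amp_def mean_cross_def sq_exact_def den_def)

lemma sq_exact_le: "sq_exact x = exp (- ((1 - r) * l) * x\<^sup>2)" by (simp add: sq_exact_def)

text \<open>With \<open>b = 1 - cos x\<close>, the numerator falls short of \<open>(den x)^2\<close>
  by at least \<open>2 l c0 b\<close>. Bounding \<open>den x\<close> by \<open>D\<close> and using
  \<open>1 + y <= exp y\<close> gives decay in \<open>1 - cos x\<close>.\<close>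

lemma mean_sq_amp_le:
  obtains c where "0 < c" "\<And>x. \<bar>x\<bar> \<le> pi \<Longrightarrow> mean_sq_amp x \<le> exp (- c * x\<^sup>2)"
proof -
  define k where "k = l * (1 - 2 * (t - r\<^sup>2))"
  define c0 where "c0 = min (1 - r) (1 - k)"
  define D where "D = 1 + 2 * l * \<bar>t\<bar>"
  have c0: "0 < c0" using r stable by (simp add: c0_def k_def)
  have D: "1 \<le> D" using l by (simp add: D_def)
  have dnD: "den x \<le> D" for x
  proof -
    have "t * (1 - cos x) \<le> \<bar>t\<bar> * 2"
      using cos_ge_minus_one[of x] by (intro mult_mono) auto
    then have "l * (t * (1 - cos x)) \<le> l * (\<bar>t\<bar> * 2)" using l by (intro mult_left_mono) auto
    then show ?thesis by (simp add: den_def D_def algebra_simps)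
  qed
  have A: "mean_sq_amp x \<le> exp (- (2 * l * c0 / D\<^sup>2) * (1 - cos x))" for x
  proof -
    define b where "b = 1 - cos x"
    have b: "0 \<le> b" "b \<le> 2" unfolding b_def using cos_ge_minus_one[of x] by auto
    have s: "(sin x)\<^sup>2 = b * (2 - b)"
      by (simp add: b_def sin_squared_eq power2_eq_square algebra_simps)
    \<comment> \<open>a convex combination of the decay rates at wave numbers \<open>0\<close> and \<open>\<pi>\<close>; the stability
      condition makes the second one positive\<close>
    have "(den x - l * b)\<^sup>2 + 2 * (l * r * b)\<^sup>2 + r * l * (sin x)\<^sup>2
      = (den x)\<^sup>2 - 2 * l * b * ((1 - b/2) * (1 - r) + b/2 * (1 - k))"
      unfolding s den_def b_def[symmetric] k_def by (simp add: power2_eq_square field_simps)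
    also have "\<dots> \<le> (den x)\<^sup>2 - 2 * l * b * c0"
    proof -
      have "c0 = (1 - b/2) * c0 + b/2 * c0" by (simp add: algebra_simps)
      also have "\<dots> \<le> (1 - b/2) * (1 - r) + b/2 * (1 - k)"
        using b by (intro add_mono mult_left_mono) (auto simp: c0_def)
      finally show ?thesis using b l by (simp add: mult_left_mono)
    qed
    finally have "mean_sq_amp x \<le> ((den x)\<^sup>2 - 2 * l * b * c0) / (den x)\<^sup>2"
      unfolding mean_sq_amp_def b_def[symmetric] by (rule divide_right_mono) simp
    also have "\<dots> = 1 - 2 * l * b * c0 / (den x)\<^sup>2" by (simp add: diff_divide_distrib)
    also have "\<dots> \<le> 1 - 2 * l * b * c0 / D\<^sup>2"
      using b l c0 dnD D den_pos[of x] by (intro diff_left_mono divide_left_mono power_mono) auto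
    also have "\<dots> = 1 + (- (2 * l * c0 / D\<^sup>2) * b)" by simp
    also have "\<dots> \<le> exp (- (2 * l * c0 / D\<^sup>2) * b)" by (rule exp_ge_add_one_self)
    finally show ?thesis by (simp add: b_def)
  qed
  \<comment> \<open>In \<open>[-pi, pi]\<close> the function \<open>1 - cos x\<close> vanishes only
    at 0, and to second order, so it is bounded below by a multiple of \<open>x^2\<close>.\<close>
  have "(\<lambda>x::real. x\<^sup>2) \<in> O[at 0](\<lambda>x. 1 - cos x)" by real_asymp
  moreover have "1 - cos x \<noteq> 0" if "x \<in> {-pi..pi}" "x \<noteq> 0" for x :: real
  proof -
    have "cos \<bar>x\<bar> < cos 0" using that by (intro cos_monotone_0_pi) auto
    then show ?thesis by simp
  qed
  ultimately obtain K where K: "0 < K" "\<And>x. \<bar>x\<bar> \<le> pi \<Longrightarrow> \<bar>x\<^sup>2\<bar> \<le> K * \<bar>1 - cos x\<bar>"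
    by (rule bigo_at_0_uniform[where R = pi]) (auto intro!: continuous_intros)
  show ?thesis
  proof
    show "0 < 2 * l * c0 / D\<^sup>2 / K" using l c0 D K by simp
    fix x :: real assume x: "\<bar>x\<bar> \<le> pi"
    have "x\<^sup>2 / K \<le> 1 - cos x" using K(2)[OF x] K(1) by (simp add: field_simps)
    then have "2 * l * c0 / D\<^sup>2 * (x\<^sup>2 / K) \<le> 2 * l * c0 / D\<^sup>2 * (1 - cos x)"
      using l c0 by (intro mult_left_mono) auto
    then have "exp (- (2 * l * c0 / D\<^sup>2) * (1 - cos x)) \<le> exp (- (2 * l * c0 / D\<^sup>2 / K) * x\<^sup>2)" by simp
    then show "mean_sq_amp x \<le> exp (- (2 * l * c0 / D\<^sup>2 / K) * x\<^sup>2)" using A[of x] by linarith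
  qed
qed

end

section \<open>Taylor expansion at wave number zero\<close>

text \<open>All functions involved are even, so a jet of order five has three coefficients, and the coefficient
  identities stay small.\<close>

definition jet4 :: "(real \<Rightarrow> real) \<Rightarrow> real \<Rightarrow> real \<Rightarrow> real \<Rightarrow> bool" where
  "jet4 f a b c \<longleftrightarrow> (\<lambda>x. f x - (a + b * x^2 + c * x^4)) \<in> O[at 0](\<lambda>x. x^6)"

lemma isCont_bigo_1:
  fixes f :: "real \<Rightarrow> real"
  assumes "isCont f 0"
  shows "f \<in> O[at 0](\<lambda>_. 1)"
proof (rule bigoI_tendsto)
  show "((\<lambda>x. f x / 1) \<longlongrightarrow> f 0) (at 0)" using assms by (simp add: isCont_def)
qed simp

lemma pow6_bigo_1: "(\<lambda>x::real. x^6) \<in> O[at 0](\<lambda>_. 1)"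
  by (intro isCont_bigo_1 continuous_intros)

lemma jet4_bigo_1:
  assumes "jet4 f a b c"
  shows "f \<in> O[at 0](\<lambda>_. 1)"
proof -
  have "(\<lambda>x. f x - (a + b * x^2 + c * x^4)) \<in> O[at 0](\<lambda>_. 1)"
    using assms pow6_bigo_1 unfolding jet4_def by (rule landau_o.big_trans)
  moreover have "(\<lambda>x. a + b * x^2 + c * x^4) \<in> O[at 0](\<lambda>_. 1)"
    by (intro isCont_bigo_1 continuous_intros)
  ultimately have "(\<lambda>x. (f x - (a + b * x^2 + c * x^4)) + (a + b * x^2 + c * x^4)) \<in> O[at 0](\<lambda>_. 1)"
    by (rule sum_in_bigo(1))
  then show ?thesis by simp
qed

lemma jet4_add:
  assumes "jet4 f a b c" "jet4 g a' b' c'"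
  shows "jet4 (\<lambda>x. f x + g x) (a + a') (b + b') (c + c')"
  using sum_in_bigo(1)[OF assms[unfolded jet4_def]] unfolding jet4_def
  by (simp add: algebra_simps)

text \<open>With truncations \<open>p\<close> and \<open>q\<close>, the product is
  \<open>f (g - q) + (f - p) q + p q\<close>, and what is dropped from \<open>p q\<close> is
  \<open>x^6\<close> times a polynomial.\<close>

lemma jet4_mult:
  assumes f: "jet4 f a b c" and g: "jet4 g a' b' c'"
  shows "jet4 (\<lambda>x. f x * g x) (a * a') (a * b' + b * a') (a * c' + b * b' + c * a')"
proof -
  let ?p = "\<lambda>x. a + b * x^2 + c * x^4" and ?q = "\<lambda>x. a' + b' * x^2 + c' * x^4"
  let ?t = "\<lambda>x. b * c' + c * b' + c * c' * x^2"
  have "(\<lambda>x. f x * (g x - ?q x)) \<in> O[at 0](\<lambda>x. 1 * x^6)"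
    using g by (intro landau_o.big.mult jet4_bigo_1[OF f]) (simp add: jet4_def)
  moreover have "(\<lambda>x. (f x - ?p x) * ?q x) \<in> O[at 0](\<lambda>x. x^6 * 1)"
    using f by (intro landau_o.big.mult isCont_bigo_1 continuous_intros) (simp add: jet4_def)
  moreover have "(\<lambda>x. x^6 * ?t x) \<in> O[at 0](\<lambda>x. x^6 * 1)"
    by (intro landau_o.big.mult isCont_bigo_1 continuous_intros) simp
  ultimately have "(\<lambda>x. (f x * (g x - ?q x) + (f x - ?p x) * ?q x) + x^6 * ?t x) \<in> O[at 0](\<lambda>x. x^6)"
    unfolding mult_1_left mult_1_right by (intro sum_in_bigo(1))
  also have "(\<lambda>x. (f x * (g x - ?q x) + (f x - ?p x) * ?q x) + x^6 * ?t x) =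
      (\<lambda>x. f x * g x - (a * a' + (a * b' + b * a') * x^2 + (a * c' + b * b' + c * a') * x^4))"
    by (simp add: fun_eq_iff algebra_simps flip: power_add)
  finally show ?thesis by (simp add: jet4_def)
qed

lemma jet4_const: "jet4 (\<lambda>_. a) a 0 0"
  by (simp add: jet4_def)

lemma jet4_power2: "jet4 (\<lambda>x. x\<^sup>2) 0 1 0"
  by (simp add: jet4_def)

lemma jet4_diff:
  assumes "jet4 f a b c" "jet4 g a' b' c'"
  shows "jet4 (\<lambda>x. f x - g x) (a - a') (b - b') (c - c')"
  using sum_in_bigo(2)[OF assms[unfolded jet4_def]] unfolding jet4_def
  by (simp add: algebra_simps)

lemma jet4_square:
  assumes "jet4 f a b c"
  shows "jet4 (\<lambda>x. (f x)\<^sup>2) (a * a) (a * b + b * a) (a * c + b * b + c * a)"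
  using jet4_mult[OF assms assms] by (simp add: power2_eq_square)

lemma jet4_x_sin: "jet4 (\<lambda>x. x * sin x) 0 1 (-1/6)"
  unfolding jet4_def by real_asymp

lemma jet4_sin_squared: "jet4 (\<lambda>x. (sin x)\<^sup>2) 0 1 (-1/3)"
  unfolding jet4_def by real_asymp

lemma jet4_cos: "jet4 cos 1 (-1/2) (1/24)"
  unfolding jet4_def by real_asymp

text \<open>Substitute \<open>y = c x^2\<close> in the expansion of \<open>exp (- y)\<close> up to
  \<open>y^3\<close>. For \<open>c = 0\<close> the inner function does not avoid 0, so that case is
  separate.\<close>

lemma jet4_exp: "jet4 (\<lambda>x. exp (- (c * x\<^sup>2))) 1 (-c) (c\<^sup>2 / 2)"
proof -
  have *: "(\<lambda>y::real. exp (- y) - (1 - y + y\<^sup>2 / 2)) \<in> O[at 0](\<lambda>y. y ^ 3)"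
    by real_asymp
  show ?thesis
  proof (cases "c = 0")
    case True
    then show ?thesis by (simp add: jet4_def)
  next
    case False
    have "filterlim (\<lambda>x. c * x\<^sup>2) (at 0) (at 0)"
      using False by (auto simp: filterlim_at eventually_at intro!: tendsto_eq_intros exI[of _ 1])
    from landau_o.big.compose[OF * this] show ?thesis
      using False by (simp add: jet4_def power_mult_distrib mult_ac flip: power_mult)
  qed
qed

text \<open>The order matters: \<open>x^2\<close>, \<open>(sin x)^2\<close>,
  \<open>x * sin x\<close> and constants come before the general square and product rules, which
  would match them too and split them into odd factors without a jet.\<close>

lemmas jet4_intros = jet4_add jet4_diff jet4_sin_squared jet4_power2 jet4_square jet4_x_sin jet4_exp
    jet4_cos
  jet4_const jet4_mult

lemma jet4_bigo_6:
  assumes "jet4 f a b c" "a = 0" "b = 0" "c = 0"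
  shows "f \<in> O[at 0](\<lambda>x. x^6)"
  using assms by (simp add: jet4_def)

lemma jet4_bigo_4:
  assumes f: "jet4 f a b c" and "a = 0" "b = 0"
  shows "f \<in> O[at 0](\<lambda>x. x^4)"
proof -
  have "(\<lambda>x. x^4 * x^2) \<in> O[at 0](\<lambda>x::real. x^4 * 1)"
    by (intro landau_o.big.mult isCont_bigo_1 continuous_intros) simp
  then have "(\<lambda>x. x^6) \<in> O[at 0](\<lambda>x::real. x^4)" by (simp flip: power_add)
  then have "(\<lambda>x. f x - (a + b * x^2 + c * x^4)) \<in> O[at 0](\<lambda>x. x^4)"
    using f unfolding jet4_def by (rule landau_o.big_trans[rotated])
  moreover have "(\<lambda>x. c * x^4) \<in> O[at 0](\<lambda>x. x^4)" by simp
  ultimately have "(\<lambda>x. (f x - (a + b * x^2 + c * x^4)) + c * x^4) \<in> O[at 0](\<lambda>x. x^4)"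
    by (rule sum_in_bigo(1))
  then show ?thesis using assms by simp
qed

section \<open>Low-order cancellation in the differences of moments\<close>

context milstein_symbol
begin

text \<open>Clearing denominators here and in \<open>cross_num\<close> lets the jet calculus do
  without a quotient rule. \<open>cross_num\<close> groups \<open>x * sin x\<close> because only the
  product, not its odd factors, has an even jet.\<close>

definition amp_num :: "real \<Rightarrow> real" where
  "amp_num x = (den x - l * (1 - cos x))\<^sup>2 + 2 * (l * r * (1 - cos x))\<^sup>2 + r * l * (sin x)\<^sup>2"

definition cross_num :: "real \<Rightarrow> real" where
  "cross_num x = exp (- (l / 2 * x\<^sup>2)) *
    (den x - l * (1 - cos x) + l * r * (1 - cos x) * (r * l * x\<^sup>2) + r * l * (x * sin x))"

lemma mean_sq_amp_eq: "mean_sq_amp x = amp_num x / (den x)\<^sup>2" and mean_cross_eq: "mean_cross x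
    = cross_num x / den x"
  by (simp_all add: mean_sq_amp_def amp_num_def mean_cross_def cross_num_def mult.assoc)

text \<open>This is \<open>(den x)^2\<close> times the mean of \<open>|amp - exact|^2\<close> for
  the one-step factors defined below. All three jet coefficients cancel, so the one-step error has
  order \<open>x^3\<close> in root mean square.\<close>

lemma moments_second_difference:
  "(\<lambda>x. amp_num x - 2 * (cross_num x * den x) + sq_exact x * (den x)\<^sup>2) \<in> O[at 0](\<lambda>x. x ^ 6)"
  apply (rule jet4_bigo_6)
     apply (simp only: amp_num_def cross_num_def den_def sq_exact_def)
     apply (rule jet4_intros)+
    apply simp
   apply (simp add: field_simps)
  apply (simp add: field_simps power2_eq_square)
  done

text \<open>Here and in \<open>exact_cross_difference\<close> order four suffices, because these
  differences enter the power estimate squared.\<close>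

lemma amp_cross_difference: "(\<lambda>x. amp_num x - cross_num x * den x) \<in> O[at 0](\<lambda>x. x ^ 4)"
  apply (rule jet4_bigo_4)
     apply (simp only: amp_num_def cross_num_def den_def sq_exact_def)
     apply (rule jet4_intros)+
    apply simp
  apply (simp add: field_simps)
  done

lemma exact_cross_difference: "(\<lambda>x. sq_exact x * den x - cross_num x) \<in> O[at 0](\<lambda>x. x ^ 4)"
  apply (rule jet4_bigo_4)
     apply (simp only: amp_num_def cross_num_def den_def sq_exact_def)
     apply (rule jet4_intros)+
    apply simp
  apply (simp add: field_simps)
  done

end

section \<open>The one-step factors and their Gaussian moments\<close>

text \<open>Times the normal density, the integrand is the derivative of
  \<open>z^k * density * iexp (- (w * z))\<close>, which vanishes at both infinities. This is a
  recursion for the moments; at \<open>k = 0\<close> the truncated exponent \<open>k - 1\<close> is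
  harmless because of the factor \<open>k\<close>.\<close>

lemma std_normal_ibp:
  fixes w :: real and k :: nat
  shows "(CLINT z|std_normal_distribution.
    (of_nat k * of_real z ^ (k - 1) - of_real z ^ (k + 1) - \<i> * of_real w * of_real z ^ k)
        * iexp (- (w * z))) = 0"
    (is "(CLINT z|_. ?f z) = 0")
proof -
  let ?d = std_normal_density
  define F where "F z = complex_of_real (z ^ k * ?d z) * iexp (- (w * z))" for z :: real
  \<comment> \<open>\<open>F\<close> continued to the complex plane, where complex differentiation
    rules apply; \<open>FG\<close> restricts it to the real line again.\<close>
  define G where "G u = u ^ k * exp (- u\<^sup>2 / 2 - \<i> * of_real w * u) / of_real (sqrt (2 * pi))"
      for u :: complex
  have e: "exp (- (of_real z)\<^sup>2 / 2 - \<i> * of_real w * of_real z) / of_real (sqrt (2 * pi))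
      = of_real (?d z) * iexp (- (w * z))" for z
  proof -
    have "exp (- (of_real z)\<^sup>2 / 2 - \<i> * of_real w * of_real z)
        = exp (complex_of_real (- z\<^sup>2 / 2)) * iexp (- (w * z))"
      by (subst exp_add[symmetric], rule arg_cong[where f = exp]) simp
    then show ?thesis by (simp add: normal_density_def flip: exp_of_real)
  qed
  have FG: "F = (\<lambda>z. G (of_real z))"
    unfolding F_def G_def times_divide_eq_right[symmetric] e by (simp add: fun_eq_iff mult_ac)
  have "(G has_field_derivative (of_nat k * u ^ (k - 1) - u ^ (k + 1) - \<i> * of_real w * u ^ k) *
      (exp (- u\<^sup>2 / 2 - \<i> * of_real w * u) / of_real (sqrt (2 * pi)))) (at u)" for u
    unfolding G_def by (auto intro!: derivative_eq_intros simp: field_simps)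
  note G = has_vector_derivative_real_field[OF this]
  have F: "(F has_vector_derivative (?d z *\<^sub>R ?f z)) (at z)" for z
    unfolding FG using G[of z UNIV, unfolded e] by (simp only: scaleR_conv_of_real mult_ac)
  have int: "integrable std_normal_distribution ?f"
  proof (rule Bochner_Integration.integrable_bound)
    show "integrable std_normal_distribution (\<lambda>z. real k * \<bar>z ^ (k - 1)\<bar> + \<bar>z ^ (k + 1)\<bar> + \<bar>w\<bar>
        * \<bar>z ^ k\<bar>)"
      by (intro Bochner_Integration.integrable_add Bochner_Integration.integrable_mult_right
          Bochner_Integration.integrable_abs integrable_std_normal_distribution_moment)
    show "AE z in std_normal_distribution. norm (?f z) \<le> norm (real k * \<bar>z ^ (k - 1)\<bar> + \<bar>z ^ (k
        + 1)\<bar> + \<bar>w\<bar> * \<bar>z ^ k\<bar>)"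
      apply (intro AE_I2)
      apply (simp add: norm_mult)
      apply (intro norm_triangle_le_diff order.trans[OF norm_triangle_ineq4] add_mono)
        apply (auto simp: norm_mult norm_power power_abs abs_mult)
      done
  qed simp
  then have int': "integrable lborel (\<lambda>z. ?d z *\<^sub>R ?f z)"
    by (subst (asm) integrable_density) (auto simp: normal_density_nonneg)
  have lim: "(F \<longlongrightarrow> 0) at_top" "(F \<longlongrightarrow> 0) at_bot"
  proof -
    have *: "norm (F z) = \<bar>z ^ k * ?d z\<bar>" for z by (simp add: F_def norm_mult norm_power abs_mult
        power_abs)
    show "(F \<longlongrightarrow> 0) at_top"
      by (rule tendsto_norm_zero_cancel, unfold *, rule tendsto_rabs_zero) (unfold
          normal_density_def, real_asymp)
    show "(F \<longlongrightarrow> 0) at_bot"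
      by (rule tendsto_norm_zero_cancel, unfold *, rule tendsto_rabs_zero) (unfold
          normal_density_def, real_asymp)
  qed
  have "(LBINT z=-\<infinity>..\<infinity>. ?d z *\<^sub>R ?f z) = 0 - 0"
  proof (rule interval_integral_FTC_integrable[where F = F])
    show "((F \<circ> real_of_ereal) \<longlongrightarrow> 0) (at_right (-\<infinity>))" "((F \<circ> real_of_ereal) \<longlongrightarrow> 0) (at_left \<infinity>)"
      using lim by (simp_all add: ereal_tendsto_simps)
    show "isCont (\<lambda>z. ?d z *\<^sub>R ?f z) x" for x
      unfolding normal_density_def by (intro continuous_intros) auto
  qed (use F int' in \<open>auto simp: set_integrable_def\<close>)
  then have "(LINT z|lborel. ?d z *\<^sub>R ?f z) = 0"
    by (simp add: interval_lebesgue_integral_def set_lebesgue_integral_def)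
  then show ?thesis
    by (subst integral_density) (auto simp: normal_density_nonneg)
qed

lemma std_normal_iexp_integrable:
  "integrable std_normal_distribution (\<lambda>z. of_real z ^ k * iexp (- (w * z)) :: complex)"
proof (rule Bochner_Integration.integrable_bound[OF integrable_std_normal_distribution_moment[of k]])
qed (auto simp: norm_mult norm_power power_abs)

text \<open>Order 0 is the characteristic function at \<open>-w\<close>; the recursion at
  \<open>k = 0\<close> and \<open>k = 1\<close> then gives orders 1 and 2.\<close>

lemma std_normal_iexp_moments:
  fixes w :: real
  defines "f \<equiv> \<lambda>k z. complex_of_real z ^ k * iexp (- (w * z))"
  shows "has_bochner_integral std_normal_distribution (f 0) (of_real (exp (- w\<^sup>2 / 2)))" (is ?m0)
    and "has_bochner_integral std_normal_distribution (f 1) (- \<i> * of_real (w * exp (- w\<^sup>2 / 2)))"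
        (is ?m1)
    and "has_bochner_integral std_normal_distribution (f 2) (of_real ((1 - w\<^sup>2) * exp (- w\<^sup>2 / 2)))"
        (is ?m2)
proof -
  define I where "I k = integral\<^sup>L std_normal_distribution (f k)" for k
  have f: "has_bochner_integral std_normal_distribution (f k) (I k)" for k
    unfolding f_def I_def by (intro has_bochner_integral_integrable std_normal_iexp_integrable)
  have 0: "I 0 = of_real (exp (- w\<^sup>2 / 2))"
    using fun_cong[OF char_std_normal_distribution, of "-w"] by (simp add: I_def f_def char_def)
  have "has_bochner_integral std_normal_distribution (\<lambda>z. - 1 * f 1 z - (\<i> * of_real w) * f 0 z)
      (- 1 * I 1 - (\<i> * of_real w) * I 0)"
    by (intro has_bochner_integral_diff has_bochner_integral_mult_right f)
  from has_bochner_integral_integral_eq[OF this] std_normal_ibp[of 0 w]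
  have 1: "I 1 = - \<i> * of_real (w * exp (- w\<^sup>2 / 2))"
    by (simp add: f_def algebra_simps 0)
  have "has_bochner_integral std_normal_distribution (\<lambda>z. f 0 z - f 2 z - (\<i> * of_real w) * f 1 z)
      (I 0 - I 2 - (\<i> * of_real w) * I 1)"
    by (intro has_bochner_integral_diff has_bochner_integral_mult_right f)
  from has_bochner_integral_integral_eq[OF this] std_normal_ibp[of 1 w]
  have "I 0 - I 2 - (\<i> * of_real w) * I 1 = 0"
    by (simp add: f_def power2_eq_square algebra_simps)
  then have 2: "I 2 = of_real ((1 - w\<^sup>2) * exp (- w\<^sup>2 / 2))"
    by (simp add: 0 1[unfolded One_nat_def] power2_eq_square algebra_simps)
  show ?m0 ?m1 ?m2
    using f[of 0] f[of 1] f[of 2] unfolding 0 1 2 by simp_all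
qed

context milstein_symbol
begin

text \<open>One step of the scheme solved for a plane wave: \<open>D1\<close> multiplies by
  \<open>2 i sin x\<close>, \<open>D2\<close> by \<open>-2 (1 - cos x)\<close>, and the implicit
  part becomes division by \<open>den x\<close>.\<close>

definition amp :: "real \<Rightarrow> real \<Rightarrow> complex" where
  "amp x z = (of_real (1 - l * (1 - r - t) * (1 - cos x) - l * r * z\<^sup>2 * (1 - cos x))
     - \<i> * of_real (sqrt (r * l) * z * sin x)) / of_real (den x)"

text \<open>At frequency \<open>x / h\<close>, the modulus is the decay over time \<open>k\<close>
  under diffusion with coefficient \<open>(1 - r) / 2\<close>, and the phase is the translation by
  \<open>sqrt r\<close> times the Brownian increment \<open>sqrt k * z\<close>.\<close>

definition exact :: "real \<Rightarrow> real \<Rightarrow> complex" where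
  "exact x z = of_real (exp (- ((1 - r) * l * x\<^sup>2 / 2))) * iexp (- (sqrt (r * l) * x * z))"

lemma norm_exact: "(norm (exact x z))\<^sup>2 = sq_exact x"
  by (simp add: exact_def sq_exact_def norm_mult power_mult_distrib flip: exp_double)

text \<open>As an even polynomial of degree four in \<open>z\<close>, this has a mean that needs
  only the Gaussian moments 1 and 3 of orders two and four.\<close>

lemma norm_amp: "(norm (amp x z))\<^sup>2 =
   ((1 - l * (1 - r - t) * (1 - cos x))\<^sup>2 / (den x)\<^sup>2
    + (r * l * (sin x)\<^sup>2 - 2 * (1 - l * (1 - r - t) * (1 - cos x)) * (l * r * (1
        - cos x))) / (den x)\<^sup>2 * z\<^sup>2
    + (l * r * (1 - cos x))\<^sup>2 / (den x)\<^sup>2 * z ^ 4)"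
proof -
  define p q where "p = 1 - l * (1 - r - t) * (1 - cos x)" and "q = l * r * (1 - cos x)"
  have "amp x z = Complex (p - q * z\<^sup>2) (- (sqrt (r * l) * z * sin x)) / of_real (den x)"
    by (simp add: amp_def complex_eq_iff p_def q_def)
  then have "(norm (amp x z))\<^sup>2 = ((p - q * z\<^sup>2)\<^sup>2 + (sqrt (r * l) * z * sin x)\<^sup>2) / (den x)\<^sup>2"
    by (simp add: norm_divide power_divide cmod_power2)
  also have "(sqrt (r * l) * z * sin x)\<^sup>2 = r * l * (sin x)\<^sup>2 * z\<^sup>2"
    using l r by (simp add: power_mult_distrib)
  also have "((p - q * z\<^sup>2)\<^sup>2 + r * l * (sin x)\<^sup>2 * z\<^sup>2) / (den x)\<^sup>2 =
     p\<^sup>2 / (den x)\<^sup>2 + (r * l * (sin x)\<^sup>2 - 2 * p * q) / (den x)\<^sup>2 * z\<^sup>2 + q\<^sup>2 / (den x)\<^sup>2 * z ^ 4"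
    by (simp add: field_simps power2_eq_square power4_eq_xxxx)
  finally show ?thesis unfolding p_def q_def .
qed

lemma norm_amp_integral:
  shows "integrable std_normal_distribution (\<lambda>z. (norm (amp x z))\<^sup>2)"
    and "(LINT z|std_normal_distribution. (norm (amp x z))\<^sup>2) = mean_sq_amp x"
proof -
  interpret N: prob_space std_normal_distribution
    using real_dist_normal_dist by (simp add: real_distribution_def)
  note [simp] = integrable_std_normal_distribution_moment
  show "integrable std_normal_distribution (\<lambda>z. (norm (amp x z))\<^sup>2)"
    unfolding norm_amp by simp
  have 2: "(LINT z|std_normal_distribution. z\<^sup>2) = 1"
    using std_normal_distribution_even_moments(1)[of 1] by simp
  have 4: "(LINT z|std_normal_distribution. z ^ 4) = 3"
    using std_normal_distribution_even_moments(1)[of 2] by (simp add: fact_numeral)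
  have "(LINT z|std_normal_distribution. (norm (amp x z))\<^sup>2) =
    (1 - l * (1 - r - t) * (1 - cos x))\<^sup>2 / (den x)\<^sup>2
    + (r * l * (sin x)\<^sup>2 - 2 * (1 - l * (1 - r - t) * (1 - cos x)) * (l * r * (1 - cos x))) / (den x)\<^sup>2
    + (l * r * (1 - cos x))\<^sup>2 / (den x)\<^sup>2 * 3"
    unfolding norm_amp by (simp add: 2 4 N.prob_space[simplified])
  also have "\<dots> = mean_sq_amp x"
    unfolding mean_sq_amp_def add_divide_distrib[symmetric]
    by (simp add: den_def power2_eq_square algebra_simps flip: add_divide_distrib diff_divide_distrib)
  finally show "(LINT z|std_normal_distribution. (norm (amp x z))\<^sup>2) = mean_sq_amp x" .
qed

text \<open>\<open>cnj amp\<close> is a quadratic polynomial in \<open>z\<close> and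
  \<open>exact\<close> a constant times \<open>iexp (- (w * z))\<close>, so the three moments above
  suffice.\<close>

lemma cnj_amp_exact_integral:
  shows "integrable std_normal_distribution (\<lambda>z. cnj (amp x z) * exact x z)"
    and "(CLINT z|std_normal_distribution. cnj (amp x z) * exact x z) = of_real (mean_cross x)"
proof -
  define w where "w = sqrt (r * l) * x"
  define p q s e :: complex where "p = of_real (1 - l * (1 - r - t) * (1 - cos x))" and "q
      = of_real (l * r * (1 - cos x))"
    and "s = of_real (sqrt (r * l) * sin x)" and "e = of_real (exp (- ((1 - r) * l * x\<^sup>2 / 2)))"
  have eq: "(\<lambda>z. cnj (amp x z) * exact x z) = (\<lambda>z. e / of_real (den x) * p * (of_real z ^ 0
      * iexp (- (w * z)))
       + e / of_real (den x) * (\<i> * s) * (of_real z ^ 1 * iexp (- (w * z)))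
       + (- e / of_real (den x) * q) * (of_real z ^ 2 * iexp (- (w * z))))"
    unfolding amp_def exact_def p_def q_def s_def e_def w_def
    by (simp add: fun_eq_iff algebra_simps diff_divide_distrib add_divide_distrib)
  let ?v = "e / of_real (den x) * p * of_real (exp (- w\<^sup>2 / 2))
       + e / of_real (den x) * (\<i> * s) * (- \<i> * of_real (w * exp (- w\<^sup>2 / 2)))
       + (- e / of_real (den x) * q) * of_real ((1 - w\<^sup>2) * exp (- w\<^sup>2 / 2))"
  have "?v = e * of_real (exp (- w\<^sup>2 / 2)) * (p + s * of_real w - q * of_real (1
      - w\<^sup>2)) / of_real (den x)"
    by (simp add: algebra_simps add_divide_distrib diff_divide_distrib)
  \<comment> \<open>The damping \<open>(1 - r) l x^2 / 2\<close> of \<open>exact\<close> and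
    \<open>w^2 / 2 = r l x^2 / 2\<close> from the Gaussian average add up to
    \<open>l x^2 / 2\<close>.\<close>
  also have "e * of_real (exp (- w\<^sup>2 / 2)) = of_real (exp (- (l * x\<^sup>2 / 2)))"
  proof -
    have "- ((1 - r) * l * x\<^sup>2 / 2) + - w\<^sup>2 / 2 = - (l * x\<^sup>2 / 2)"
      using l r by (simp add: w_def power_mult_distrib field_simps)
    then show ?thesis unfolding e_def by (metis exp_add of_real_mult)
  qed
  also have "p + s * of_real w - q * of_real (1 - w\<^sup>2) = of_real
     (den x - l * (1 - cos x) + l * r * (1 - cos x) * (r * l * x\<^sup>2) + r * l * x * sin x)"
    unfolding p_def s_def w_def q_def of_real_mult[symmetric] of_real_add[symmetric]
        of_real_diff[symmetric] of_real_eq_iff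
    using l r by (simp add: power_mult_distrib den_def algebra_simps)
  finally have v: "?v = of_real (mean_cross x)" by (simp add: mean_cross_def)
  have "has_bochner_integral std_normal_distribution (\<lambda>z. cnj (amp x z) * exact x z) ?v"
    unfolding eq by (intro has_bochner_integral_add has_bochner_integral_mult_right
        std_normal_iexp_moments)
  then show "integrable std_normal_distribution (\<lambda>z. cnj (amp x z) * exact x z)"
    and "(CLINT z|std_normal_distribution. cnj (amp x z) * exact x z) = of_real (mean_cross x)"
    unfolding has_bochner_integral_iff v by blast+
qed

text \<open>Arithmetic-geometric mean inequality under the integral. It transfers the Gaussian decay
  of the other two moments to \<open>mean_cross\<close>.\<close>

lemma abs_mean_cross_le: "\<bar>mean_cross x\<bar> \<le> (mean_sq_amp x + sq_exact x) / 2"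
proof -
  interpret N: prob_space std_normal_distribution
    using real_dist_normal_dist by (simp add: real_distribution_def)
  have "norm (CLINT z|std_normal_distribution. cnj (amp x z) * exact x z)
      \<le> (LINT z|std_normal_distribution. norm (cnj (amp x z) * exact x z))"
    by (rule integral_norm_bound)
  also have "\<dots> \<le> (LINT z|std_normal_distribution. ((norm (amp x z))\<^sup>2 + sq_exact x) / 2)"
  proof (rule integral_mono)
    show "integrable std_normal_distribution (\<lambda>z. norm (cnj (amp x z) * exact x z))"
      by (intro integrable_norm cnj_amp_exact_integral)
    show "integrable std_normal_distribution (\<lambda>z. ((norm (amp x z))\<^sup>2 + sq_exact x) / 2)"
      using norm_amp_integral(1) by simp
    show "norm (cnj (amp x z) * exact x z) \<le> ((norm (amp x z))\<^sup>2 + sq_exact x) / 2" for z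
      using sum_squares_bound[of "norm (amp x z)" "norm (exact x z)"]
      by (simp add: norm_mult norm_exact)
  qed
  also have "\<dots> = (mean_sq_amp x + sq_exact x) / 2"
    using norm_amp_integral[of x] by (simp add: N.prob_space[simplified])
  finally show ?thesis by (simp add: cnj_amp_exact_integral)
qed


section \<open>Powers of the moments, uniformly in the wave number\<close>

lemma mean_sq_amp_nonneg: "0 \<le> mean_sq_amp x"
  unfolding mean_sq_amp_def using r l by (intro divide_nonneg_nonneg add_nonneg_nonneg
      mult_nonneg_nonneg) auto

lemma moments_taylor_bounds:
  obtains K where "0 < K"
    "\<And>x. \<bar>x\<bar> \<le> pi \<Longrightarrow> \<bar>mean_sq_amp x - 2 * mean_cross x + sq_exact x\<bar> \<le> K * x ^ 6"
    "\<And>x. \<bar>x\<bar> \<le> pi \<Longrightarrow> \<bar>mean_sq_amp x - mean_cross x\<bar> \<le> K * x ^ 4"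
    "\<And>x. \<bar>x\<bar> \<le> pi \<Longrightarrow> \<bar>sq_exact x - mean_cross x\<bar> \<le> K * x ^ 4"
proof -
  have den_1: "(\<lambda>x. 1 / (den x) ^ n) \<in> O[at 0](\<lambda>_. 1)" for n
    by (intro isCont_bigo_1 continuous_intros continuous_den) (auto simp: den_def intro!:
        continuous_intros)
  have quot: "(\<lambda>x. f x / (den x) ^ n) \<in> O[at 0](\<lambda>x. x ^ m)" if "f \<in> O[at 0](\<lambda>x. x ^ m)" for f n m
    using landau_o.big.mult[OF that den_1[of n]] by simp
  note * = continuous_intros continuous_moments
  obtain K1 where K1: "0 < K1" "\<And>x. \<bar>x\<bar> \<le> pi \<Longrightarrow> \<bar>mean_sq_amp x - 2 * mean_cross x + sq_exact x\<bar>
      \<le> K1 * \<bar>x ^ 6\<bar>"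
  proof (rule bigo_at_0_uniform[where R = pi and g = "\<lambda>x. x ^ 6"])
    show "(\<lambda>x. mean_sq_amp x - 2 * mean_cross x + sq_exact x) \<in> O[at 0](\<lambda>x. x ^ 6)"
      using quot[OF moments_second_difference, of 2]
      by (simp add: mean_sq_amp_eq mean_cross_eq add_divide_distrib diff_divide_distrib
          power2_eq_square)
  qed (auto intro!: *)
  obtain K2 where K2: "0 < K2" "\<And>x. \<bar>x\<bar> \<le> pi \<Longrightarrow> \<bar>mean_sq_amp x - mean_cross x\<bar> \<le> K2 * \<bar>x ^ 4\<bar>"
  proof (rule bigo_at_0_uniform[where R = pi and g = "\<lambda>x. x ^ 4"])
    show "(\<lambda>x. mean_sq_amp x - mean_cross x) \<in> O[at 0](\<lambda>x. x ^ 4)"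
      using quot[OF amp_cross_difference, of 2]
      by (simp add: mean_sq_amp_eq mean_cross_eq diff_divide_distrib power2_eq_square)
  qed (auto intro!: *)
  obtain K3 where K3: "0 < K3" "\<And>x. \<bar>x\<bar> \<le> pi \<Longrightarrow> \<bar>sq_exact x - mean_cross x\<bar> \<le> K3 * \<bar>x ^ 4\<bar>"
  proof (rule bigo_at_0_uniform[where R = pi and g = "\<lambda>x. x ^ 4"])
    show "(\<lambda>x. sq_exact x - mean_cross x) \<in> O[at 0](\<lambda>x. x ^ 4)"
      using quot[OF exact_cross_difference, of 1]
      by (simp add: mean_cross_eq diff_divide_distrib)
  qed (auto intro!: *)
  show ?thesis
  proof
    show "0 < K1 + K2 + K3" using K1 K2 K3 by simp
    fix x assume x: "\<bar>x\<bar> \<le> pi"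
    have "K1 * \<bar>x ^ 6\<bar> \<le> (K1 + K2 + K3) * \<bar>x ^ 6\<bar>" "K2 * \<bar>x ^ 4\<bar> \<le> (K1 + K2 + K3) * \<bar>x ^ 4\<bar>"
      "K3 * \<bar>x ^ 4\<bar> \<le> (K1 + K2 + K3) * \<bar>x ^ 4\<bar>"
      using K1 K2 K3 by (intro mult_right_mono; simp)+
    moreover have "\<bar>x ^ 6\<bar> = x ^ 6" "\<bar>x ^ 4\<bar> = x ^ 4" by (simp_all add: power_even_abs)
    ultimately show "\<bar>mean_sq_amp x - 2 * mean_cross x + sq_exact x\<bar> \<le> (K1 + K2 + K3) * x ^ 6"
      "\<bar>mean_sq_amp x - mean_cross x\<bar> \<le> (K1 + K2 + K3) * x ^ 4" "\<bar>sq_exact x - mean_cross x\<bar>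
          \<le> (K1 + K2 + K3) * x ^ 4"
      using K1(2)[OF x] K2(2)[OF x] K3(2)[OF x] by simp_all
  qed
qed

text \<open>Linearise the three powers at \<open>b = mean_cross x\<close>: the linear part is a multiple of the second difference,
  and the remainders are quadratic in the first differences.\<close>

lemma moments_power_bound:
  obtains K c where "0 < K" "0 < c" "c \<le> (1 - r) * l / 4"
    "\<And>N x. 2 \<le> N \<Longrightarrow> \<bar>x\<bar> \<le> pi \<Longrightarrow>
       mean_sq_amp x ^ N - 2 * mean_cross x ^ N + sq_exact x ^ N
           \<le> K / (real N)\<^sup>2 * exp (- c * real N * x\<^sup>2)"
proof -
  obtain c1 where c1: "0 < c1" "\<And>x. \<bar>x\<bar> \<le> pi \<Longrightarrow> mean_sq_amp x \<le> exp (- c1 * x\<^sup>2)"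
      using mean_sq_amp_le by blast
  define c where "c = min c1 ((1 - r) * l)"
  have c: "0 < c" using c1 l r by (simp add: c_def)
  obtain K where K: "0 < K"
    "\<And>x. \<bar>x\<bar> \<le> pi \<Longrightarrow> \<bar>mean_sq_amp x - 2 * mean_cross x + sq_exact x\<bar> \<le> K * x ^ 6"
    "\<And>x. \<bar>x\<bar> \<le> pi \<Longrightarrow> \<bar>mean_sq_amp x - mean_cross x\<bar> \<le> K * x ^ 4"
    "\<And>x. \<bar>x\<bar> \<le> pi \<Longrightarrow> \<bar>sq_exact x - mean_cross x\<bar> \<le> K * x ^ 4"
    using moments_taylor_bounds by blast
  obtain K3 where K3: "0 < K3" "\<And>y. 0 \<le> y \<Longrightarrow> y ^ 3 \<le> K3 * exp (c/2 * y)"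
    using power_le_exp[OF half_gt_zero[OF c], of 3] by blast
  obtain K4 where K4: "0 < K4" "\<And>y. 0 \<le> y \<Longrightarrow> y ^ 4 \<le> K4 * exp (c/2 * y)"
    using power_le_exp[OF half_gt_zero[OF c], of 4] by blast
  \<comment> \<open>The exponential factor pays for the exponent \<open>N - 2\<close> instead of
    \<open>N\<close> on \<mu>; \<open>K3\<close> and \<open>K4\<close> absorb powers of
    \<open>N x^2\<close> into half of the exponent.\<close>
  define K' where "K' = exp (2 * c * pi\<^sup>2) * (K * K3 + 2 * K\<^sup>2 * K4)"
  show ?thesis
  proof
    show "0 < K'" using K(1) K3(1) K4(1) by (simp add: K'_def add_pos_pos)
    show "0 < c / 4" using c by simp
    show "c / 4 \<le> (1 - r) * l / 4" by (simp add: c_def)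
    fix N :: nat and x :: real
    assume N: "2 \<le> N" and x: "\<bar>x\<bar> \<le> pi"
    obtain n where n: "N = n + 2" using N by (metis le_add_diff_inverse2)
    define \<mu> where "\<mu> = exp (- c * x\<^sup>2)"
    have \<mu>: "0 \<le> \<mu>" "\<mu> \<le> 1" using c by (auto simp: \<mu>_def)
    have "exp (- c1 * x\<^sup>2) \<le> \<mu>" by (simp add: \<mu>_def c_def mult_right_mono)
    then have A: "\<bar>mean_sq_amp x\<bar> \<le> \<mu>" using c1(2)[OF x] mean_sq_amp_nonneg[of x] by simp
    have F: "\<bar>sq_exact x\<bar> \<le> \<mu>" unfolding sq_exact_le by (simp add: \<mu>_def c_def mult_right_mono)
    have "mean_sq_amp x \<le> \<mu>" "sq_exact x \<le> \<mu>" using A F by (simp_all add: abs_le_iff)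
    then have B: "\<bar>mean_cross x\<bar> \<le> \<mu>" using abs_mean_cross_le[of x] by argo
    define a b f where "a = mean_sq_amp x" and "b = mean_cross x" and "f = sq_exact x"
    let ?ra = "a ^ N - b ^ N - real N * b ^ (n + 1) * (a - b)"
    let ?rf = "f ^ N - b ^ N - real N * b ^ (n + 1) * (f - b)"
    have sq: "(u - b)\<^sup>2 \<le> K\<^sup>2 * x ^ 8" if "\<bar>u - b\<bar> \<le> K * x ^ 4" for u
    proof -
      have "\<bar>u - b\<bar>\<^sup>2 \<le> (K * x ^ 4)\<^sup>2" using that by (intro power_mono) auto
      then show ?thesis by (simp add: power_mult_distrib flip: power_mult)
    qed
    have rem: "\<bar>u ^ N - b ^ N - real N * b ^ (n + 1) * (u - b)\<bar> \<le> (real N)\<^sup>2 * \<mu> ^ n * (K\<^sup>2 * x ^ 8)"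
      if "\<bar>u\<bar> \<le> \<mu>" "\<bar>u - b\<bar> \<le> K * x ^ 4" for u
    proof -
      have "\<bar>u ^ N - b ^ N - real N * b ^ (n + 1) * (u - b)\<bar> \<le> (real N)\<^sup>2 * \<mu> ^ n * (u - b)\<^sup>2"
        unfolding n using that(1) B b_def by (intro power_remainder_bound) auto
      also have "\<dots> \<le> (real N)\<^sup>2 * \<mu> ^ n * (K\<^sup>2 * x ^ 8)"
        using \<mu> by (intro mult_left_mono sq that) auto
      finally show ?thesis .
    qed
    have "real N * b ^ (n + 1) * (a - 2 * b + f) \<le> \<bar>real N * b ^ (n + 1) * (a - 2 * b + f)\<bar>" by simp
    also have "\<dots> = real N * (\<bar>b\<bar> * \<bar>b\<bar> ^ n) * \<bar>a - 2 * b + f\<bar>" by (simp add: abs_mult power_abs)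
    also have "\<dots> \<le> real N * (1 * \<mu> ^ n) * (K * x ^ 6)"
      using B \<mu> K(2)[OF x] unfolding a_def b_def f_def
      by (intro mult_mono power_mono mult_nonneg_nonneg) auto
    finally have lin: "real N * b ^ (n + 1) * (a - 2 * b + f) \<le> real N * \<mu> ^ n * (K * x ^ 6)" by simp
    have "a ^ N - 2 * b ^ N + f ^ N = ?ra + ?rf + real N * b ^ (n + 1) * (a - 2 * b + f)"
      by (simp add: algebra_simps)
    also have "\<dots> \<le> (real N)\<^sup>2 * \<mu> ^ n * (K\<^sup>2 * x ^ 8) + (real N)\<^sup>2 * \<mu> ^ n * (K\<^sup>2 * x ^ 8) + real N
        * \<mu> ^ n * (K * x ^ 6)"
      using A F K(3,4)[OF x] by (intro add_mono lin abs_le_D1[OF rem]) (simp_all add: a_def b_def f_def)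
    \<comment> \<open>The source of \<open>1 / N^2\<close>: \<open>N x^6 = (N x^2)^3 / N^2\<close>
      and \<open>N^2 x^8 = (N x^2)^4 / N^2\<close>.\<close>
    also have "\<dots> = \<mu> ^ n * (K * (real N * x\<^sup>2) ^ 3 + 2 * K\<^sup>2 * (real N * x\<^sup>2) ^ 4) / (real N)\<^sup>2"
      using N by (simp add: field_simps power_mult_distrib eval_nat_numeral)
    also have "\<dots> \<le> exp (2 * c * pi\<^sup>2) * exp (- c * (real N * x\<^sup>2)) *
        (K * (K3 * exp (c/2 * (real N * x\<^sup>2))) + 2 * K\<^sup>2 * (K4 * exp (c/2 * (real N
            * x\<^sup>2)))) / (real N)\<^sup>2"
    proof (intro divide_right_mono mult_mono add_mono K3(2) K4(2))
      have "\<mu> ^ n = exp (2 * c * x\<^sup>2 + - c * (real N * x\<^sup>2))"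
        by (simp add: \<mu>_def n algebra_simps flip: exp_of_nat_mult)
      also have "\<dots> \<le> exp (2 * c * pi\<^sup>2 + - c * (real N * x\<^sup>2))"
        using c x by (simp add: flip: abs_le_square_iff)
      finally show "\<mu> ^ n \<le> exp (2 * c * pi\<^sup>2) * exp (- c * (real N * x\<^sup>2))" by (simp only: exp_add)
    qed (use K in auto)
    also have "\<dots> = K' / (real N)\<^sup>2 * (exp (- c * (real N * x\<^sup>2)) * exp (c/2 * (real N * x\<^sup>2)))"
      by (simp add: K'_def algebra_simps add_divide_distrib)
    also have "exp (- c * (real N * x\<^sup>2)) * exp (c/2 * (real N * x\<^sup>2)) = exp (- (c/2) * (real N * x\<^sup>2))"
      by (simp flip: exp_add)
    also have "K' / (real N)\<^sup>2 * exp (- (c/2) * (real N * x\<^sup>2))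
        \<le> K' / (real N)\<^sup>2 * exp (- (c/4) * real N * x\<^sup>2)"
      using c \<open>0 < K'\<close> by (intro mult_left_mono) auto
    finally show "mean_sq_amp x ^ N - 2 * mean_cross x ^ N + sq_exact x ^ N
        \<le> K' / (real N)\<^sup>2 * exp (- (c / 4) * real N * x\<^sup>2)"
      by (simp add: a_def b_def f_def)
  qed
qed

end

section \<open>A large sieve inequality with Gaussian weight\<close>

text \<open>The characteristic function of the standard normal law, rescaled by
  \<open>s = sqrt (2 * c)\<close>.\<close>

lemma gaussian_fourier:
  fixes c y :: real
  assumes c: "0 < c"
  shows "has_bochner_integral lborel (\<lambda>x. iexp (y * x) * complex_of_real (exp (- (c * x\<^sup>2))))
     (of_real (sqrt (pi / c) * exp (- y\<^sup>2 / (4 * c))))"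
proof -
  define s where "s = sqrt (2 * c)"
  have s: "0 < s" "s\<^sup>2 = 2 * c" using c by (simp_all add: s_def)
  define w where "w = y / s"
  let ?f = "\<lambda>x. iexp (y * x) * complex_of_real (exp (- (c * x\<^sup>2)))"
  have "integrable std_normal_distribution (\<lambda>u. iexp (w * u))"
    by (rule Bochner_Integration.integrable_bound[OF integrable_std_normal_distribution_moment[of
        0]]) auto
  moreover have "(CLINT u|std_normal_distribution. iexp (w * u)) = of_real (exp (- w\<^sup>2 / 2))"
    using fun_cong[OF char_std_normal_distribution, of w] by (simp add: char_def)
  ultimately have "has_bochner_integral std_normal_distribution (\<lambda>u. iexp (w
      * u)) (of_real (exp (- w\<^sup>2 / 2)))"
    by (simp add: has_bochner_integral_iff)
  then have "has_bochner_integral lborel (\<lambda>u. std_normal_density u *\<^sub>R iexp (w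
      * u)) (of_real (exp (- w\<^sup>2 / 2)))"
    by (simp add: has_bochner_integral_iff integrable_density integral_density normal_density_nonneg)
  then have "has_bochner_integral lborel (\<lambda>u. of_real (sqrt (2 * pi))
      * (std_normal_density u *\<^sub>R iexp (w * u)))
     (of_real (sqrt (2 * pi)) * of_real (exp (- w\<^sup>2 / 2)))"
    by (rule has_bochner_integral_mult_right)
  also have "(\<lambda>u. of_real (sqrt (2 * pi)) * (std_normal_density u *\<^sub>R iexp (w * u)))
      = (\<lambda>u. ?f (0 + 1 / s * u))"
    using s c by (simp add: fun_eq_iff normal_density_def w_def scaleR_conv_of_real power_divide
        field_simps)
  finally have "has_bochner_integral lborel (\<lambda>u. ?f (0 + 1 / s * u)) (of_real (sqrt (pi / c)
      * exp (- y\<^sup>2 / (4 * c))) /\<^sub>R \<bar>1 / s\<bar>)"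
  proof (rule back_subst[where P = "has_bochner_integral _ _"])
    have "w\<^sup>2 / 2 = y\<^sup>2 / (4 * c)" using s by (simp add: w_def power_divide)
    moreover have "sqrt (2 * pi) = sqrt (pi / c) * s"
      using c by (simp add: s_def flip: real_sqrt_mult)
    ultimately show "complex_of_real (sqrt (2 * pi)) * of_real (exp (- w\<^sup>2 / 2)) =
       of_real (sqrt (pi / c) * exp (- y\<^sup>2 / (4 * c))) /\<^sub>R \<bar>1 / s\<bar>"
      using s by (simp add: scaleR_conv_of_real mult_ac)
  qed
  then show ?thesis
    using s by (subst lborel_has_bochner_integral_real_affine_iff[where c = "1 / s" and t = 0]) auto
qed

lemma gaussian_integral:
  assumes "0 < (c::real)"
  shows "has_bochner_integral lborel (\<lambda>x. exp (- (c * x\<^sup>2))) (sqrt (pi / c))"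
proof -
  have "has_bochner_integral lborel (\<lambda>x. complex_of_real (exp (- (c * x\<^sup>2)))) (of_real (sqrt (pi / c)))"
    using gaussian_fourier[OF assms, of 0] by simp
  from has_bochner_integral_Re[OF this] show ?thesis by simp
qed

text \<open>For integers \<open>(j - k)^2 >= |j - k|\<close>, so each side of \<open>j\<close>
  contributes at most a geometric series. The bound is uniform in \<open>J\<close> and
  \<open>j\<close>, as Schur's test requires.\<close>

lemma gaussian_row_sum:
  obtains K where "0 < K" "\<And>(J :: int set) j. finite J \<Longrightarrow> (\<Sum>k\<in>J. exp (- (real_of_int (j - k))\<^sup>2 / 2))
      \<le> K"
proof -
  let ?q = "exp (- 1 / 2 :: real)"
  have q: "?q < 1" "0 < ?q" by auto
  have geo: "(\<Sum>i\<in>I. ?q ^ i) \<le> 1 / (1 - ?q)" if "finite I" for I :: "nat set"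
  proof -
    have "(\<Sum>i\<in>I. ?q ^ i) \<le> (\<Sum>i. ?q ^ i)"
      using q that by (intro sum_le_suminf summable_geometric) auto
    then show ?thesis using q by (simp add: suminf_geometric)
  qed
  show ?thesis
  proof
    show "0 < 2 * (1 / (1 - ?q))" using q by simp
    fix J :: "int set" and j assume J: "finite J"
    let ?n = "\<lambda>k. nat \<bar>j - k\<bar>"
    have "(\<Sum>k\<in>J. exp (- (real_of_int (j - k))\<^sup>2 / 2)) \<le> (\<Sum>k\<in>J. ?q ^ ?n k)"
    proof (rule sum_mono)
      fix k
      have "\<bar>j - k\<bar> \<le> (j - k)\<^sup>2"
        using self_le_power[of "\<bar>j - k\<bar>" 2] by (cases "j = k") auto
      then have "real_of_int \<bar>j - k\<bar> \<le> (real_of_int (j - k))\<^sup>2" by (metis of_int_le_iff of_int_power)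
      moreover have "real (?n k) = real_of_int \<bar>j - k\<bar>" by simp
      ultimately show "exp (- (real_of_int (j - k))\<^sup>2 / 2) \<le> ?q ^ ?n k"
        by (simp flip: exp_of_nat_mult)
    qed
    also have "\<dots> = (\<Sum>k\<in>J \<inter> {..j}. ?q ^ ?n k) + (\<Sum>k\<in>J \<inter> {j<..}. ?q ^ ?n k)"
      using J by (subst sum.union_disjoint[symmetric]) (auto intro!: sum.cong)
    also have "(\<Sum>k\<in>J \<inter> {..j}. ?q ^ ?n k) = (\<Sum>i\<in>?n ` (J \<inter> {..j}). ?q ^ i)"
      by (subst sum.reindex) (auto simp: inj_on_def)
    also have "(\<Sum>k\<in>J \<inter> {j<..}. ?q ^ ?n k) = (\<Sum>i\<in>?n ` (J \<inter> {j<..}). ?q ^ i)"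
      by (subst sum.reindex) (auto simp: inj_on_def)
    finally show "(\<Sum>k\<in>J. exp (- (real_of_int (j - k))\<^sup>2 / 2)) \<le> 2 * (1 / (1 - ?q))"
      using geo[of "?n ` (J \<inter> {..j})"] geo[of "?n ` (J \<inter> {j<..})"] J by simp
  qed
qed

text \<open>Split \<open>|g|\<close> as \<open>|g| exp (x^2 / 4)\<close> times
  \<open>exp (- x^2 / 4)\<close> and apply the arithmetic-geometric mean inequality.\<close>

lemma integrable_gaussian_weight:
  fixes g :: "real \<Rightarrow> complex"
  assumes g [measurable]: "g \<in> borel_measurable borel"
    and G: "integrable lborel (\<lambda>x. (norm (g x))\<^sup>2 * exp (x\<^sup>2 / 2))"
  shows "integrable lborel g"
proof (rule Bochner_Integration.integrable_bound)
  show "integrable lborel (\<lambda>x. (norm (g x))\<^sup>2 * exp (x\<^sup>2 / 2) + exp (- (1/2 * x\<^sup>2)))"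
    using G gaussian_integral[of "1/2"] by (intro Bochner_Integration.integrable_add) (auto simp:
        has_bochner_integral_iff)
  show "AE x in lborel. norm (g x) \<le> norm ((norm (g x))\<^sup>2 * exp (x\<^sup>2 / 2) + exp (- (1/2 * x\<^sup>2)))"
  proof (rule AE_I2)
    fix x :: real
    define a where "a = exp (x\<^sup>2 / 4)"
    have a: "0 < a" "exp (x\<^sup>2 / 2) = a\<^sup>2" "exp (- (1/2 * x\<^sup>2)) = inverse a ^ 2"
      by (simp_all add: a_def exp_minus power_inverse flip: exp_double)
    have "2 * (norm (g x) * a) * inverse a \<le> (norm (g x) * a)\<^sup>2 + (inverse a)\<^sup>2"
      by (rule sum_squares_bound)
    then have "2 * norm (g x) \<le> (norm (g x))\<^sup>2 * exp (x\<^sup>2 / 2) + exp (- (1/2 * x\<^sup>2))"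
      unfolding a(2,3) using a(1) by (simp add: power_mult_distrib mult.assoc)
    then show "norm (g x) \<le> norm ((norm (g x))\<^sup>2 * exp (x\<^sup>2 / 2) + exp (- (1/2 * x\<^sup>2)))"
      using norm_ge_zero[of "g x"] by (simp only: real_norm_def)
  qed
qed simp

text \<open>Expanding \<open>|P|^2\<close> and integrating gives a quadratic form in
  \<open>c\<close> with a Gaussian kernel in \<open>j - k\<close>; its row sums are bounded by
  \<open>sqrt (2 * pi) * K\<close>, and Schur's test applies.\<close>

lemma trig_polynomial_gaussian:
  fixes c :: "int \<Rightarrow> complex"
  assumes J: "finite J" and K: "0 < K" "\<And>j. (\<Sum>k\<in>J. exp (- (real_of_int (j - k))\<^sup>2 / 2)) \<le> K"
  defines "P \<equiv> \<lambda>x. \<Sum>j\<in>J. c j * iexp (real_of_int j * x)"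
  shows "integrable lborel (\<lambda>x. (norm (P x))\<^sup>2 * exp (- (x\<^sup>2 / 2)))"
    and "(LINT x|lborel. (norm (P x))\<^sup>2 * exp (- (x\<^sup>2 / 2)))
        \<le> sqrt (2 * pi) * K * (\<Sum>j\<in>J. (norm (c j))\<^sup>2)"
proof -
  let ?e = "\<lambda>j k. exp (- (real_of_int (j - k))\<^sup>2 / 2)"
  define v where "v = (\<Sum>j\<in>J. \<Sum>k\<in>J. c j * cnj (c k) * of_real (sqrt (2 * pi) * ?e j k))"
  have eq: "complex_of_real ((norm (P x))\<^sup>2 * exp (- (x\<^sup>2 / 2))) =
     (\<Sum>j\<in>J. \<Sum>k\<in>J. c j * cnj (c k) * (iexp (real_of_int (j - k) * x) * of_real (exp (- (1/2
         * x\<^sup>2)))))" for x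
  proof -
    have "complex_of_real ((norm (P x))\<^sup>2) = P x * cnj (P x)" by (simp only: complex_norm_square)
    also have "\<dots> = (\<Sum>j\<in>J. \<Sum>k\<in>J. c j * cnj (c k) * iexp (real_of_int (j - k) * x))"
      unfolding P_def cnj_sum sum_product
      by (intro sum.cong refl) (simp add: algebra_simps exp_diff exp_minus field_simps exp_cnj)
    finally show ?thesis by (simp add: sum_distrib_left sum_distrib_right mult_ac)
  qed
  have v: "has_bochner_integral lborel (\<lambda>x. complex_of_real ((norm (P x))\<^sup>2 * exp (- (x\<^sup>2 / 2)))) v"
    unfolding eq v_def
  proof (intro has_bochner_integral_sum has_bochner_integral_mult_right)
    fix j k
    show "has_bochner_integral lborel (\<lambda>x. iexp (real_of_int (j - k) * x)
        * complex_of_real (exp (- (1/2 * x\<^sup>2))))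
        (of_real (sqrt (2 * pi) * ?e j k))"
      using gaussian_fourier[of "1/2" "real_of_int (j - k)"] by (simp add: mult.commute)
  qed
  from has_bochner_integral_Re[OF v] have hb: "has_bochner_integral lborel (\<lambda>x. (norm (P x))\<^sup>2
      * exp (- (x\<^sup>2 / 2))) (Re v)"
    by (simp only: Re_complex_of_real)
  show "integrable lborel (\<lambda>x. (norm (P x))\<^sup>2 * exp (- (x\<^sup>2 / 2)))"
    using hb by (simp add: has_bochner_integral_iff)
  have "Re v \<le> norm v" by (rule complex_Re_le_cmod)
  also have "\<dots> \<le> (\<Sum>j\<in>J. \<Sum>k\<in>J. norm (c j) * norm (c k) * (sqrt (2 * pi) * ?e j k))"
    unfolding v_def by (intro sum_norm_le) (simp add: norm_mult)
  also have "\<dots> \<le> (\<Sum>j\<in>J. \<Sum>k\<in>J. ((norm (c j))\<^sup>2 + (norm (c k))\<^sup>2) / 2 * (sqrt (2 * pi) * ?e j k))"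
  proof (intro sum_mono mult_right_mono)
    fix j k show "norm (c j) * norm (c k) \<le> ((norm (c j))\<^sup>2 + (norm (c k))\<^sup>2) / 2"
      using sum_squares_bound[of "norm (c j)" "norm (c k)"] by simp
  qed auto
  also have "\<dots> = (\<Sum>j\<in>J. \<Sum>k\<in>J. (norm (c j))\<^sup>2 * sqrt (2 * pi) / 2 * ?e j k)
      + (\<Sum>j\<in>J. \<Sum>k\<in>J. (norm (c k))\<^sup>2 * sqrt (2 * pi) / 2 * ?e j k)"
    by (simp add: algebra_simps add_divide_distrib flip: sum.distrib)
  also have "(\<Sum>j\<in>J. \<Sum>k\<in>J. (norm (c k))\<^sup>2 * sqrt (2 * pi) / 2 * ?e j k)
      = (\<Sum>j\<in>J. \<Sum>k\<in>J. (norm (c j))\<^sup>2 * sqrt (2 * pi) / 2 * ?e j k)"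
    by (subst sum.swap) (simp add: power2_commute)
  also have "(\<Sum>j\<in>J. \<Sum>k\<in>J. (norm (c j))\<^sup>2 * sqrt (2 * pi) / 2 * ?e j k) + (\<Sum>j\<in>J. \<Sum>k\<in>J. (norm (c j))\<^sup>2
      * sqrt (2 * pi) / 2 * ?e j k)
    = (\<Sum>j\<in>J. (norm (c j))\<^sup>2 * sqrt (2 * pi) * (\<Sum>k\<in>J. ?e j k))"
    by (simp add: sum_distrib_left mult_ac flip: sum.distrib)
  also have "\<dots> \<le> (\<Sum>j\<in>J. (norm (c j))\<^sup>2 * sqrt (2 * pi) * K)"
    by (intro sum_mono mult_left_mono K(2)) auto
  also have "\<dots> = sqrt (2 * pi) * K * (\<Sum>j\<in>J. (norm (c j))\<^sup>2)"
    by (simp add: sum_distrib_left mult_ac)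
  finally show "(LINT x|lborel. (norm (P x))\<^sup>2 * exp (- (x\<^sup>2 / 2)))
      \<le> sqrt (2 * pi) * K * (\<Sum>j\<in>J. (norm (c j))\<^sup>2)"
    using hb by (simp add: has_bochner_integral_iff)
qed

text \<open>Duality: \<open>\<Sum>\<bar>c j\<bar>\<^sup>2 = \<integral> P g\<close> for the trigonometric polynomial \<open>P\<close> with coefficients \<open>cnj (c j)\<close>, whose
  Gaussian-weighted \<open>L\<^sub>2\<close> norm is controlled by Schur's test.\<close>

lemma gaussian_sieve:
  obtains K :: real where "0 < K"
    "\<And>g :: real \<Rightarrow> complex. g \<in> borel_measurable borel \<Longrightarrow>
      (\<Sum>\<^sub>\<infinity>j::int. ennreal ((norm (CLINT x|lborel. iexp (real_of_int j * x) * g x))\<^sup>2))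
      \<le> ennreal K * (\<integral>\<^sup>+x. ennreal ((norm (g x))\<^sup>2 * exp (x\<^sup>2 / 2)) \<partial>lborel)"
proof -
  obtain K where K: "0 < K" "\<And>(J :: int set) j. finite J
      \<Longrightarrow> (\<Sum>k\<in>J. exp (- (real_of_int (j - k))\<^sup>2 / 2)) \<le> K"
    using gaussian_row_sum by blast
  define L where "L = sqrt (2 * pi) * K"
  have L: "0 < L" using K(1) by (simp add: L_def)
  show ?thesis
  proof
    show "0 < L" by (rule L)
    fix g :: "real \<Rightarrow> complex" assume g [measurable]: "g \<in> borel_measurable borel"
    let ?G = "\<lambda>x. (norm (g x))\<^sup>2 * exp (x\<^sup>2 / 2)"
    define c where "c j = (CLINT x|lborel. iexp (real_of_int j * x) * g x)" for j :: int
    show "(\<Sum>\<^sub>\<infinity>j::int. ennreal ((norm (CLINT x|lborel. iexp (real_of_int j * x) * g x))\<^sup>2))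
      \<le> ennreal L * (\<integral>\<^sup>+x. ennreal (?G x) \<partial>lborel)"
    proof (cases "(\<integral>\<^sup>+x. ennreal (?G x) \<partial>lborel) = \<infinity>")
      case True
      then show ?thesis using L by (simp add: ennreal_mult_top)
    next
      case False
      then have G: "integrable lborel ?G"
        by (intro integrableI_bounded) (auto simp: less_top)
      have gi: "integrable lborel (\<lambda>x. iexp (real_of_int j * x) * g x)" for j :: int
        by (rule Bochner_Integration.integrable_bound[OF integrable_gaussian_weight[OF g G]]) (auto
            simp: norm_mult)
      have fin: "(\<Sum>j\<in>J. (norm (c j))\<^sup>2) \<le> L * (LINT x|lborel. ?G x)" if J: "finite J" for J
      proof -
        define S where "S = (\<Sum>j\<in>J. (norm (c j))\<^sup>2)"
        define P where "P x = (\<Sum>j\<in>J. cnj (c j) * iexp (real_of_int j * x))" for x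
        note P = trig_polynomial_gaussian[OF J K(1) K(2)[OF J], of "\<lambda>j. cnj (c j)", folded P_def]
        have "complex_of_real S = (\<Sum>j\<in>J. cnj (c j) * c j)"
          unfolding S_def of_real_sum by (intro sum.cong refl) (simp only: complex_norm_square
              mult.commute)
        also have "\<dots> = (CLINT x|lborel. P x * g x)"
          using gi by (simp add: P_def c_def sum_distrib_right mult.assoc)
        finally have "S = Re (CLINT x|lborel. P x * g x)" by (metis Re_complex_of_real)
        also have "\<dots> \<le> norm (CLINT x|lborel. P x * g x)" by (rule complex_Re_le_cmod)
        also have "\<dots> \<le> (LINT x|lborel. norm (P x * g x))" by (rule integral_norm_bound)
        \<comment> \<open>The weights \<open>L / 2\<close> and \<open>1 / (2 L)\<close> make the
          second term at most \<open>S / 2\<close>, which the left side absorbs.\<close>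
        also have "\<dots> \<le> (LINT x|lborel. L / 2 * ?G x + 1 / (2 * L) * ((norm (P x))\<^sup>2
            * exp (- (x\<^sup>2 / 2))))"
        proof (rule integral_mono)
          show "integrable lborel (\<lambda>x. norm (P x * g x))"
            unfolding P_def sum_distrib_right mult.assoc
            by (intro integrable_norm Bochner_Integration.integrable_sum
                Bochner_Integration.integrable_mult_right gi)
          show "integrable lborel (\<lambda>x. L / 2 * ?G x + 1 / (2 * L) * ((norm (P x))\<^sup>2
              * exp (- (x\<^sup>2 / 2))))"
            by (intro Bochner_Integration.integrable_add Bochner_Integration.integrable_mult_right G P)
          fix x :: real
          define a where "a = sqrt L * exp (x\<^sup>2 / 4)"
          have a: "0 < a" "L * exp (x\<^sup>2 / 2) = a\<^sup>2" using L
              by (simp_all add: a_def power_mult_distrib flip: exp_double)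
          have "1 / L * exp (- (x\<^sup>2 / 2)) = 1 / (L * exp (x\<^sup>2 / 2))"
              by (simp add: exp_minus field_simps)
          then have a2: "1 / L * exp (- (x\<^sup>2 / 2)) = (1 / a)\<^sup>2" unfolding a(2)
              by (simp add: power_divide)
          have "2 * (norm (g x) * a) * (norm (P x) * (1 / a))
              \<le> (norm (g x) * a)\<^sup>2 + (norm (P x) * (1 / a))\<^sup>2"
            by (rule sum_squares_bound)
          then have "2 * (norm (P x) * norm (g x)) \<le> (norm (g x))\<^sup>2 * a\<^sup>2 + (norm (P x))\<^sup>2 * (1 / a)\<^sup>2"
            using a(1) by (simp add: power_mult_distrib power_divide mult_ac)
          then show "norm (P x * g x) \<le> L / 2 * ?G x + 1 / (2 * L) * ((norm (P x))\<^sup>2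
              * exp (- (x\<^sup>2 / 2)))"
            unfolding a2[symmetric] a(2)[symmetric] by (simp add: norm_mult field_simps)
        qed
        also have "\<dots> = L / 2 * (LINT x|lborel. ?G x) + 1 / (2 * L) * (LINT x|lborel. (norm (P x))\<^sup>2
            * exp (- (x\<^sup>2 / 2)))"
          by (subst Bochner_Integration.integral_add) (use G P(1) in simp_all)
        also have "\<dots> \<le> L / 2 * (LINT x|lborel. ?G x) + 1 / (2 * L) * (L * S)"
          using P(2) L by (intro add_left_mono mult_left_mono) (auto simp: L_def S_def)
        finally show ?thesis using L by (simp add: S_def field_simps)
      qed
      have "(\<Sum>\<^sub>\<infinity>j::int. ennreal ((norm (c j))\<^sup>2)) \<le> ennreal (L * (LINT x|lborel. ?G x))"
      proof (rule infsum_le_finite_sums)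
        show "(\<lambda>j. ennreal ((norm (c j))\<^sup>2)) summable_on UNIV"
            by (rule nonneg_summable_on_complete) simp
        fix J :: "int set" assume "finite J"
        from fin[OF this] show "(\<Sum>j\<in>J. ennreal ((norm (c j))\<^sup>2)) \<le> ennreal (L * (LINT x|lborel. ?G x))"
          by (simp add: sum_ennreal ennreal_leI)
      qed
      also have "\<dots> = ennreal L * (\<integral>\<^sup>+x. ennreal (?G x) \<partial>lborel)"
        using L G by (subst nn_integral_eq_integral) (auto simp: ennreal_mult integral_nonneg_AE)
      finally show ?thesis by (simp add: c_def)
    qed
  qed
qed

section \<open>Fourier representation of the scheme and of the solution\<close>

text \<open>Only finitely many entries can be as large as a given nonzero one, so the supremum is a
  maximum over a finite set.\<close>

lemma in_ell2_attains_max: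
  assumes "in_ell2 W"
  obtains i where "\<And>j. \<bar>W j\<bar> \<le> \<bar>W i\<bar>"
proof (cases "\<forall>j. W j = 0")
  case True
  then show ?thesis using that[of 0] by simp
next
  case False
  then obtain m where m: "W m \<noteq> 0" by blast
  define A where "A = {j. \<bar>W m\<bar> \<le> \<bar>W j\<bar>}"
  let ?S = "\<Sum>\<^sub>\<infinity>j. (W j)\<^sup>2"
  have "finite A"
  proof (rule ccontr)
    assume "infinite A"
    then obtain F where F: "F \<subseteq> A" "finite F" "card F = nat \<lceil>?S / (W m)\<^sup>2\<rceil> + 1"
      using infinite_arbitrarily_large by metis
    have "?S / (W m)\<^sup>2 < real (card F)" unfolding F(3) by linarith
    then have "?S < real (card F) * (W m)\<^sup>2" using m by (simp add: divide_less_eq)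
    also have "\<dots> = (\<Sum>j\<in>F. (W m)\<^sup>2)" by simp
    also have "\<dots> \<le> (\<Sum>j\<in>F. (W j)\<^sup>2)"
      using F(1) by (intro sum_mono) (auto simp: A_def abs_le_square_iff)
    also have "\<dots> \<le> ?S"
      using assms F by (intro finite_sum_le_infsum) (auto simp: in_ell2_def)
    finally show False by simp
  qed
  then have fin: "finite ((\<lambda>j. \<bar>W j\<bar>) ` A)" "(\<lambda>j. \<bar>W j\<bar>) ` A \<noteq> {}" by (auto simp: A_def)
  obtain i where i: "i \<in> A" "\<bar>W i\<bar> = Max ((\<lambda>j. \<bar>W j\<bar>) ` A)" using Max_in[OF fin] by auto
  have "\<bar>W j\<bar> \<le> \<bar>W i\<bar>" for j
  proof (cases "j \<in> A")
    case True
    then show ?thesis using fin unfolding i(2) by (intro Max_ge) auto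
  next
    case False
    then show ?thesis using i(1) by (auto simp: A_def)
  qed
  then show ?thesis using that by blast
qed

lemma in_ell2_diff:
  assumes "in_ell2 V" "in_ell2 W"
  shows "in_ell2 (\<lambda>j. V j - W j)"
  unfolding in_ell2_def
proof (rule summable_on_comparison_test)
  show "(\<lambda>j. 2 * (V j)\<^sup>2 + 2 * (W j)\<^sup>2) summable_on UNIV"
    using assms unfolding in_ell2_def by (intro summable_on_add summable_on_cmult_right)
  show "(V j - W j)\<^sup>2 \<le> 2 * (V j)\<^sup>2 + 2 * (W j)\<^sup>2" for j
    using zero_le_power2[of "V j + W j"] by (simp add: power2_eq_square algebra_simps)
qed simp

text \<open>Maximum principle: at a point where \<open>\<bar>W\<bar>\<close> is largest the centre term of the implicit operator
  dominates its two neighbours.\<close>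

lemma implicit_step_kernel:
  assumes W: "in_ell2 W" and b: "- 1 < 4 * b" and eq: "\<And>j. W j = b * D2 W j"
  shows "W j = 0"
proof -
  obtain i where i: "\<And>j. \<bar>W j\<bar> \<le> \<bar>W i\<bar>" using in_ell2_attains_max[OF W] by blast
  have "(1 + 2 * b) * W i = b * (W (i + 1) + W (i - 1))"
    using eq[of i] by (simp add: D2_def algebra_simps)
  then have "\<bar>1 + 2 * b\<bar> * \<bar>W i\<bar> = \<bar>b\<bar> * \<bar>W (i + 1) + W (i - 1)\<bar>" by (metis abs_mult)
  also have "\<dots> \<le> \<bar>b\<bar> * (\<bar>W i\<bar> + \<bar>W i\<bar>)"
    using i[of "i + 1"] i[of "i - 1"] by (intro mult_left_mono) auto
  finally have "(\<bar>1 + 2 * b\<bar> - 2 * \<bar>b\<bar>) * \<bar>W i\<bar> \<le> 0" by (simp add: algebra_simps)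
  \<comment> \<open>The difference is 1 for \<open>b >= 0\<close> and \<open>1 + 4 b\<close> for
    negative \<open>b\<close> above \<open>-1/4\<close>.\<close>
  moreover have "0 < \<bar>1 + 2 * b\<bar> - 2 * \<bar>b\<bar>" using b by linarith
  ultimately have "W i = 0" by (metis mult_pos_pos not_le zero_less_abs_iff)
  then show ?thesis using i[of j] by simp
qed

section \<open>Fourier coefficients of band-limited functions\<close>

definition band :: "(real \<Rightarrow> complex) \<Rightarrow> real \<Rightarrow> complex" where
  "band f x = indicator {-pi..pi} x *\<^sub>R f x"

text \<open>Inverse Fourier transform at integers, without the factor \<open>1 / (2 pi)\<close>.
  Integration over the whole line lets one operator serve both the scheme, cut off by
  \<open>band\<close>, and the solution.\<close>

definition ft :: "(real \<Rightarrow> complex) \<Rightarrow> int \<Rightarrow> complex" where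
  "ft g j = (CLINT x|lborel. iexp (real_of_int j * x) * g x)"

lemma band_integrable:
  fixes f :: "real \<Rightarrow> complex"
  assumes "continuous_on UNIV f"
  shows "integrable lborel (\<lambda>x. iexp (real_of_int j * x) * band f x)"
proof -
  have "integrable lborel (\<lambda>x. indicator {-pi..pi} x *\<^sub>R (iexp (real_of_int j * x) * f x))"
    by (intro borel_integrable_compact continuous_intros continuous_on_subset[OF assms]) auto
  then show ?thesis by (simp add: band_def scaleR_conv_of_real mult_ac)
qed

lemma band_measurable:
  assumes "continuous_on UNIV f"
  shows "band f \<in> borel_measurable borel"
proof -
  have [measurable]: "f \<in> borel_measurable borel" using assms by (rule borel_measurable_continuous_onI)
  show ?thesis unfolding band_def[abs_def] by measurable
qed

lemma ft_band: "continuous_on UNIV f \<Longrightarrow> has_bochner_integral lborel (\<lambda>x. iexp (real_of_int j * x)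
    * band f x) (ft (band f) j)"
  unfolding ft_def by (intro has_bochner_integral_integrable band_integrable)

text \<open>The sieve replaces Parseval's identity here: its weight \<open>exp (x^2 / 2)\<close> is
  bounded on the band. Square-summability is what the uniqueness argument needs.\<close>

lemma ft_band_ell2:
  assumes f: "continuous_on UNIV f"
  shows "in_ell2 (\<lambda>j. Re (ft (band f) j) / c)"
proof -
  obtain K :: real where K: "0 < K"
    "\<And>g :: real \<Rightarrow> complex. g \<in> borel_measurable borel \<Longrightarrow>
      (\<Sum>\<^sub>\<infinity>j::int. ennreal ((norm (ft g j))\<^sup>2)) \<le> ennreal K * (\<integral>\<^sup>+x. ennreal ((norm (g x))\<^sup>2
          * exp (x\<^sup>2 / 2)) \<partial>lborel)"
    using gaussian_sieve unfolding ft_def by blast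
  have "integrable lborel (\<lambda>x. indicator {-pi..pi} x *\<^sub>R ((norm (f x))\<^sup>2 * exp (x\<^sup>2 / 2)))"
    by (intro borel_integrable_compact continuous_intros continuous_on_subset[OF f]) auto
  also have "(\<lambda>x. indicator {-pi..pi} x *\<^sub>R ((norm (f x))\<^sup>2 * exp (x\<^sup>2 / 2)))
      = (\<lambda>x. (norm (band f x))\<^sup>2 * exp (x\<^sup>2 / 2))"
    by (auto simp: fun_eq_iff band_def indicator_def)
  finally have "(\<integral>\<^sup>+x. ennreal ((norm (band f x))\<^sup>2 * exp (x\<^sup>2 / 2)) \<partial>lborel) < \<infinity>"
    by (simp add: nn_integral_eq_integral)
  then have "ennreal K * (\<integral>\<^sup>+x. ennreal ((norm (band f x))\<^sup>2 * exp (x\<^sup>2 / 2)) \<partial>lborel) < \<infinity>"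
    by (simp add: ennreal_mult_less_top)
  with K(2)[OF band_measurable[OF f]]
  have fin: "(\<Sum>\<^sub>\<infinity>j::int. ennreal ((norm (ft (band f) j))\<^sup>2)) < \<infinity>" by (rule le_less_trans)
  have sum: "(\<lambda>j::int. (norm (ft (band f) j))\<^sup>2) summable_on UNIV"
  proof (rule nonneg_bdd_above_summable_on)
    let ?S = "\<Sum>\<^sub>\<infinity>j::int. ennreal ((norm (ft (band f) j))\<^sup>2)"
    have "sum (\<lambda>j. (norm (ft (band f) j))\<^sup>2) F \<le> enn2real ?S" if "finite F" for F
    proof -
      have "ennreal (\<Sum>j\<in>F. (norm (ft (band f) j))\<^sup>2) \<le> ?S"
        using that by (simp add: nonneg_infsum_complete SUP_upper flip: sum_ennreal)
      then have "enn2real (ennreal (\<Sum>j\<in>F. (norm (ft (band f) j))\<^sup>2)) \<le> enn2real ?S"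
        using fin by (intro enn2real_mono) auto
      then show ?thesis by (simp add: sum_nonneg)
    qed
    then show "bdd_above (sum (\<lambda>j. (norm (ft (band f) j))\<^sup>2) ` {F. F \<subseteq> UNIV \<and> finite F})"
      by (intro bdd_aboveI[of _ "enn2real ?S"]) auto
  qed simp
  have "(\<lambda>j. 1 / c\<^sup>2 * (norm (ft (band f) j))\<^sup>2) summable_on UNIV"
    by (rule summable_on_cmult_right[OF sum])
  then show ?thesis unfolding in_ell2_def
  proof (rule summable_on_comparison_test)
    fix j
    have "(Re (ft (band f) j))\<^sup>2 \<le> (norm (ft (band f) j))\<^sup>2"
      using abs_Re_le_cmod by (simp add: abs_le_square_iff[symmetric])
    then show "(Re (ft (band f) j) / c)\<^sup>2 \<le> 1 / c\<^sup>2 * (norm (ft (band f) j))\<^sup>2"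
      by (simp add: power_divide divide_right_mono)
  qed simp
qed

text \<open>Orthogonality of the characters; divided by \<open>2 pi h\<close>, this is the Dirac
  initial data.\<close>

lemma ft_band_1: "ft (band (\<lambda>_. 1)) j = (if j = 0 then of_real (2 * pi) else 0)"
proof -
  have eq: "ft (band (\<lambda>_. 1)) j = (LBINT x. indicator {-pi..pi} x *\<^sub>R iexp (real_of_int j * x))"
    by (simp add: ft_def band_def scaleR_conv_of_real mult_ac)
  show ?thesis
  proof (cases "j = 0")
    case True
    have "(LBINT x. indicator {-pi..pi} x *\<^sub>R (1::complex)) = of_real (LBINT x. indicator {-pi..pi} x)"
      by (simp add: scaleR_conv_of_real)
    then show ?thesis unfolding eq using True by (simp add: scaleR_conv_of_real)
  next
    case False
    have "(LBINT x. indicator {-pi..pi} x *\<^sub>R iexp (real_of_int j * x))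
       = iexp (real_of_int j * pi) / (\<i> * of_int j) - iexp (real_of_int j * (-pi)) / (\<i> * of_int j)"
    proof (rule integral_FTC_atLeastAtMost)
      fix x :: real
      have "((\<lambda>u. exp (\<i> * of_int j * u) / (\<i> * of_int j)) has_field_derivative exp (\<i> * of_int j
          * of_real x)) (at (of_real x))"
        using False by (auto intro!: derivative_eq_intros)
      from has_vector_derivative_real_field[OF this]
      show "((\<lambda>x. iexp (real_of_int j * x) / (\<i> * of_int j)) has_vector_derivative iexp (real_of_int
          j * x)) (at x within {-pi..pi})"
        by (simp add: mult.assoc)
    qed (auto intro!: continuous_intros)
    also have "\<dots> = 0"
    proof -
      have "sin (real_of_int j * pi) = 0" using sin_npi_int[of j] by (simp add: mult.commute)
      then have "iexp (real_of_int j * pi) = iexp (real_of_int j * (-pi))"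
        by (intro complex_eqI) (simp_all add: Re_exp Im_exp)
      then show ?thesis by simp
    qed
    finally show ?thesis using False eq by simp
  qed
qed

context milstein_symbol
begin

lemma continuous_amp [continuous_intros]: "continuous_on UNIV (\<lambda>x. amp x z)"
  unfolding amp_def by (intro continuous_intros) auto

lemma continuous_amp_prod: "continuous_on UNIV (\<lambda>x. \<Prod>i<n. amp x (Z i))"
  by (intro continuous_intros)

text \<open>Shifting \<open>j\<close> by one multiplies the integrand by \<open>iexp x\<close> or
  its conjugate, so under the integral the claim is the defining relation of \<open>amp\<close>
  multiplied out by \<open>den x\<close>.\<close>

lemma ft_amp_step:
  fixes f :: "real \<Rightarrow> complex" and z :: real
  assumes f: "continuous_on UNIV f"
  defines "F \<equiv> ft (band f)" and "G \<equiv> ft (band (\<lambda>x. amp x z * f x))"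
  shows "G j = F j + of_real (t * l / 2) * (G (j + 1) - 2 * G j + G (j - 1))
     + of_real ((1 - r - t + r * z\<^sup>2) * l / 2) * (F (j + 1) - 2 * F j + F (j - 1))
     - of_real (sqrt (r * l) * z / 2) * (F (j + 1) - F (j - 1))" (is "_ = ?R")
proof -
  define g where "g x = amp x z * f x" for x
  have g: "continuous_on UNIV g" unfolding g_def using f by (intro continuous_intros)
  define X where "X j x = iexp (real_of_int j * x)" for j :: int and x
  note hb = ft_band[OF f, folded F_def X_def] ft_band[OF g, folded X_def, unfolded g_def, folded
      G_def, folded g_def]
  have "has_bochner_integral lborel (\<lambda>x. X j x * band f x
       + of_real (t * l / 2) * (X (j + 1) x * band g x - 2 * (X j x * band g x) + X (j - 1) x
           * band g x)
     + of_real ((1 - r - t + r * z\<^sup>2) * l / 2) * (X (j + 1) x * band f x - 2 * (X j x * band f x)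
         + X (j - 1) x * band f x)
     - of_real (sqrt (r * l) * z / 2) * (X (j + 1) x * band f x - X (j - 1) x * band f x)) ?R"
    by (intro has_bochner_integral_add has_bochner_integral_diff has_bochner_integral_mult_right hb)
  also have "(\<lambda>x. X j x * band f x
       + of_real (t * l / 2) * (X (j + 1) x * band g x - 2 * (X j x * band g x) + X (j - 1) x
           * band g x)
     + of_real ((1 - r - t + r * z\<^sup>2) * l / 2) * (X (j + 1) x * band f x - 2 * (X j x * band f x)
         + X (j - 1) x * band f x)
     - of_real (sqrt (r * l) * z / 2) * (X (j + 1) x * band f x - X (j - 1) x * band f x))
         = (\<lambda>x. X j x * band g x)"
  proof
    fix x
    define c s :: complex where "c = of_real (cos x)" and "s = of_real (sin x)"
    have X: "X (j + 1) x = X j x * (c + \<i> * s)" "X (j - 1) x = X j x * (c - \<i> * s)"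
    proof -
      have "iexp x = c + \<i> * s" "iexp (- x) = c - \<i> * s"
        by (auto simp: c_def s_def complex_eq_iff Re_exp Im_exp)
      moreover have "X (j + 1) x = X j x * iexp x" "X (j - 1) x = X j x * iexp (- x)"
        unfolding X_def exp_add[symmetric] by (simp_all add: algebra_simps)
      ultimately show "X (j + 1) x = X j x * (c + \<i> * s)" "X (j - 1) x = X j x * (c - \<i> * s)"
          by simp_all
    qed
    have "of_real (den x) * amp x z = 1 - of_real (l * (1 - r - t + r * z\<^sup>2)) * (1 - c) - \<i>
        * of_real (sqrt (r * l) * z) * s"
    proof -
      have "of_real (den x) * amp x z = of_real (1 - l * (1 - r - t) * (1 - cos x) - l * r * z\<^sup>2
          * (1 - cos x))
          - \<i> * of_real (sqrt (r * l) * z * sin x)"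
        by (simp add: amp_def)
      also have "\<dots> = 1 - of_real (l * (1 - r - t + r * z\<^sup>2)) * (1 - c) - \<i> * of_real (sqrt (r * l)
          * z) * s"
        by (simp add: c_def s_def algebra_simps)
      finally show ?thesis .
    qed
    then have "of_real (den x) * g x = (1 - of_real (l * (1 - r - t + r * z\<^sup>2)) * (1 - c) - \<i>
        * of_real (sqrt (r * l) * z) * s) * f x"
      unfolding g_def by (simp only: mult.assoc[symmetric])
    then have "(1 + of_real (l * t) * (1 - c)) * band g x
        = (1 - of_real (l * (1 - r - t + r * z\<^sup>2)) * (1 - c) - \<i> * of_real (sqrt (r * l) * z) * s)
            * band f x"
      by (cases "x \<in> {-pi..pi}") (simp_all add: band_def den_def c_def)
    moreover define \<alpha> \<beta> \<gamma> :: complex where "\<alpha> = of_real (t * l / 2)"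
      and "\<beta> = of_real ((1 - r - t + r * z\<^sup>2) * l / 2)" and "\<gamma> = of_real (sqrt (r * l) * z / 2)"
    moreover have "complex_of_real (l * t) = 2 * \<alpha>" "complex_of_real (l * (1 - r - t + r * z\<^sup>2))
        = 2 * \<beta>"
      "complex_of_real (sqrt (r * l) * z) = 2 * \<gamma>"
      by (simp_all add: \<alpha>_def \<beta>_def \<gamma>_def)
    ultimately have "(1 + 2 * \<alpha> * (1 - c)) * band g x = (1 - 2 * \<beta> * (1 - c) - \<i> * (2 * \<gamma>) * s)
        * band f x"
      by (simp only:)
    then have "X j x * band f x
       + \<alpha> * (X j x * (c + \<i> * s) * band g x - 2 * (X j x * band g x) + X j x * (c - \<i> * s) * band g x)
     + \<beta> * (X j x * (c + \<i> * s) * band f x - 2 * (X j x * band f x) + X j x * (c - \<i> * s) * band f x)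
     - \<gamma> * (X j x * (c + \<i> * s) * band f x - X j x * (c - \<i> * s) * band f x) = X j x * band g x"
      by algebra
    then show "X j x * band f x
       + of_real (t * l / 2) * (X (j + 1) x * band g x - 2 * (X j x * band g x) + X (j - 1) x
           * band g x)
     + of_real ((1 - r - t + r * z\<^sup>2) * l / 2) * (X (j + 1) x * band f x - 2 * (X j x * band f x)
         + X (j - 1) x * band f x)
     - of_real (sqrt (r * l) * z / 2) * (X (j + 1) x * band f x - X (j - 1) x * band f x)
         = X j x * band g x"
      unfolding X \<alpha>_def \<beta>_def \<gamma>_def .
  qed
  finally have "has_bochner_integral lborel (\<lambda>x. X j x * band g x) ?R" .
  from has_bochner_integral_eq[OF hb(2) this] show ?thesis .
qed

text \<open>Induction on \<open>n\<close>: the Fourier candidate \<open>U\<close> is square-summable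
  and solves the same implicit equation as \<open>V (Suc n)\<close>, so their difference lies in the
  trivial kernel of the implicit operator.\<close>

lemma milstein_scheme_fourier:
  assumes V: "milstein_scheme r \<theta> \<sigma> k h N Z V" and t: "t = \<theta> - r * \<sigma>"
    and k: "0 < k" and h: "h = sqrt (k / l)" and n: "n \<le> N"
  shows "V n j = Re (ft (band (\<lambda>x. \<Prod>i<n. amp x (Z i))) j) / (2 * pi * h)"
  using n
proof (induction n arbitrary: j)
  case 0
  have "0 < h" using h k l by simp
  then show ?case using V by (auto simp: milstein_scheme_def dirac_data_def ft_band_1)
next
  case (Suc n)
  have h2: "0 < h" "h\<^sup>2 = k / l" using h k l by simp_all
  define f where "f = (\<lambda>x. \<Prod>i<n. amp x (Z i))"
  define F where "F = ft (band f)"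
  define G where "G = ft (band (\<lambda>x. amp x (Z n) * f x))"
  define U where "U j = Re (G j) / (2 * pi * h)" for j
  have f: "continuous_on UNIV f" unfolding f_def by (rule continuous_amp_prod)
  have Vn: "V n = (\<lambda>j. Re (F j) / (2 * pi * h))"
    using Suc by (auto simp: F_def f_def)
  have U: "U j = V n j + t * l / 2 * D2 U j + (1 - r - t + r * (Z n)\<^sup>2) * l / 2 * D2 (V n) j
      - sqrt (r * l) * Z n / 2 * D1 (V n) j" for j
  proof -
    have "Re (G j) = Re (F j) + t * l / 2 * (Re (G (j + 1)) - 2 * Re (G j) + Re (G (j - 1)))
     + (1 - r - t + r * (Z n)\<^sup>2) * l / 2 * (Re (F (j + 1)) - 2 * Re (F j) + Re (F (j - 1)))
     - sqrt (r * l) * Z n / 2 * (Re (F (j + 1)) - Re (F (j - 1)))"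
      using arg_cong[OF ft_amp_step[OF f, of "Z n" j, folded F_def G_def], of Re]
      by (simp only: plus_complex.sel minus_complex.sel Re_complex_of_real Im_complex_of_real
          times_complex.sel mult_zero_left diff_zero complex_Re_numeral complex_Im_numeral)
    then have "Re (G j) / (2 * pi * h) = (Re (F j) + t * l / 2 * (Re (G (j + 1)) - 2 * Re (G j)
        + Re (G (j - 1)))
     + (1 - r - t + r * (Z n)\<^sup>2) * l / 2 * (Re (F (j + 1)) - 2 * Re (F j) + Re (F (j - 1)))
     - sqrt (r * l) * Z n / 2 * (Re (F (j + 1)) - Re (F (j - 1)))) / (2 * pi * h)" by simp
    then show ?thesis unfolding U_def Vn D2_def D1_def
      by (simp add: add_divide_distrib diff_divide_distrib algebra_simps)
  qed
  have kh: "k / (2 * h\<^sup>2) = l / 2" "r * k / (2 * h\<^sup>2) = r * l / 2" "sqrt (r * k) / (2 * h)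
      = sqrt (r * l) / 2"
  proof -
    show "k / (2 * h\<^sup>2) = l / 2" "r * k / (2 * h\<^sup>2) = r * l / 2" using h2 k l
        by (simp_all add: field_simps)
    have "sqrt (r * k) = sqrt (r * l) * h" using k l by (simp add: h flip: real_sqrt_mult)
    then show "sqrt (r * k) / (2 * h) = sqrt (r * l) / 2" using h2 by simp
  qed
  have W: "V (Suc n) j = V n j + t * l / 2 * D2 (V (Suc n)) j + (1 - r - t + r * (Z n)\<^sup>2) * l / 2
      * D2 (V n) j
      - sqrt (r * l) * Z n / 2 * D1 (V n) j" for j
  proof -
    have "milstein_step r \<theta> \<sigma> k h (Z n) (V n) (V (Suc n))"
      using V Suc.prems by (auto simp: milstein_scheme_def)
    then have "V (Suc n) j = V n j
        + \<theta> * (l / 2) * D2 (V (Suc n)) j + (1 - \<theta>) * (l / 2) * D2 (V n) j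
        - \<sigma> * (r * l / 2) * D2 (V (Suc n)) j - (1 - \<sigma>) * (r * l / 2) * D2 (V n) j
        - sqrt (r * l) / 2 * Z n * D1 (V n) j + r * l / 2 * (Z n)\<^sup>2 * D2 (V n) j"
      unfolding milstein_step_def kh[symmetric] by (simp add: mult_ac)
    then show ?thesis unfolding t by (simp add: field_simps)
  qed
  have "V (Suc n) j - U j = 0" for j
  proof (rule implicit_step_kernel[where b = "t * l / 2" and W = "\<lambda>j. V (Suc n) j - U j"])
    have "in_ell2 U" unfolding U_def G_def
      using f by (intro ft_band_ell2 continuous_intros)
    then show "in_ell2 (\<lambda>j. V (Suc n) j - U j)"
      using V Suc.prems by (intro in_ell2_diff) (auto simp: milstein_scheme_def)
    \<comment> \<open>\<open>den pi = 1 + 2 l t\<close>, so its positivity is exactly the condition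
      on \<open>b\<close> in \<open>implicit_step_kernel\<close>.\<close>
    have "0 < den pi" by (rule den_pos)
    then show "- 1 < 4 * (t * l / 2)" by (simp add: den_def mult_ac)
    show "V (Suc n) i - U i = t * l / 2 * D2 (\<lambda>j. V (Suc n) j - U j) i" for i
      using W[of i] U[of i] by (simp add: D2_def algebra_simps)
  qed
  then show ?case by (simp add: U_def G_def f_def mult.commute)
qed

text \<open>The transform of a Gaussian in grid units: the variance \<open>(1 - r) N k\<close>
  equals \<open>2 c h^2\<close>, and the centre \<open>sqrt r * m\<close> becomes a phase.\<close>

lemma spde_solution_fourier:
  assumes N: "0 < N" and k: "0 < k" and h: "h = sqrt (k / l)"
  shows "integrable lborel (\<lambda>x. iexp (real_of_int j * x) *
      (iexp (- (sqrt r * m / h) * x) * of_real (exp (- ((1 - r) * l * real N / 2 * x\<^sup>2)))))"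
    and "spde_solution r m (real N * k) (real_of_int j * h) =
     Re (ft (\<lambda>x. iexp (- (sqrt r * m / h) * x) * of_real (exp (- ((1 - r) * l * real N / 2
         * x\<^sup>2)))) j) / (2 * pi * h)"
proof -
  have h2: "0 < h" "h\<^sup>2 = k / l" using h k l by simp_all
  define c where "c = (1 - r) * l * real N / 2"
  have c: "0 < c" using l r N by (simp add: c_def)
  define y where "y = real_of_int j - sqrt r * m / h"
  have "(\<lambda>x. iexp (y * x) * complex_of_real (exp (- (c * x\<^sup>2)))) =
      (\<lambda>x. iexp (real_of_int j * x) * (iexp (- (sqrt r * m / h) * x) * of_real (exp (- (c * x\<^sup>2)))))"
    unfolding mult.assoc[symmetric] exp_add[symmetric] y_def by (simp add: fun_eq_iff algebra_simps)
  with gaussian_fourier[OF c, of y]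
  have hb: "has_bochner_integral lborel (\<lambda>x. iexp (real_of_int j * x) * (iexp (- (sqrt r * m / h)
      * x) * of_real (exp (- (c * x\<^sup>2)))))
      (of_real (sqrt (pi / c) * exp (- y\<^sup>2 / (4 * c))))" by simp
  then show "integrable lborel (\<lambda>x. iexp (real_of_int j * x) *
      (iexp (- (sqrt r * m / h) * x) * of_real (exp (- ((1 - r) * l * real N / 2 * x\<^sup>2)))))"
    by (simp add: has_bochner_integral_iff c_def)
  have Tc: "(1 - r) * (real N * k) = 2 * c * h\<^sup>2" using l by (simp add: c_def h2 field_simps)
  have "spde_solution r m (real N * k) (real_of_int j * h) =
     1 / sqrt (2 * pi * (2 * c * h\<^sup>2)) * exp (- ((real_of_int j * h - sqrt r * m)\<^sup>2 / (2 * (2 * c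
         * h\<^sup>2))))"
    unfolding spde_solution_def Tc[symmetric] by (simp add: mult_ac)
  also have "(real_of_int j * h - sqrt r * m)\<^sup>2 / (2 * (2 * c * h\<^sup>2)) = y\<^sup>2 / (4 * c)"
  proof -
    have "real_of_int j * h - sqrt r * m = y * h" using h2 by (simp add: y_def field_simps)
    then show ?thesis using h2(1) by (simp add: power_mult_distrib)
  qed
  also have "1 / sqrt (2 * pi * (2 * c * h\<^sup>2)) = sqrt (pi / c) / (2 * pi * h)"
  proof -
    have "2 * pi * (2 * c * h\<^sup>2) = (2 * h)\<^sup>2 * (pi * c)" by (simp add: power2_eq_square)
    then have "sqrt (2 * pi * (2 * c * h\<^sup>2)) = 2 * h * (sqrt pi * sqrt c)"
      using h2(1) by (simp add: real_sqrt_mult)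
    moreover have "pi = sqrt pi * sqrt pi" by simp
    ultimately show ?thesis using c h2(1) by (simp add: real_sqrt_divide field_simps)
  qed
  finally show "spde_solution r m (real N * k) (real_of_int j * h) =
     Re (ft (\<lambda>x. iexp (- (sqrt r * m / h) * x) * of_real (exp (- ((1 - r) * l * real N / 2
         * x\<^sup>2)))) j) / (2 * pi * h)"
    using has_bochner_integral_integral_eq[OF hb] by (simp add: ft_def c_def)
qed

end

section \<open>Mean-square error\<close>

text \<open>Generic in the field because it serves both the real squared modulus and the complex
  cross term.\<close>

lemma (in prob_space) indep_std_normal_prod:
  fixes g :: "real \<Rightarrow> 'b :: {real_normed_field, banach, second_countable_topology}"
  assumes indep: "indep_vars (\<lambda>_. borel) Z {..<N}"
    and dist: "\<And>i. i < N \<Longrightarrow> distributed M lborel (Z i) std_normal_density"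
    and g: "has_bochner_integral std_normal_distribution g v"
  shows "has_bochner_integral M (\<lambda>\<omega>. \<Prod>i<N. g (Z i \<omega>)) (v ^ N)"
proof -
  have gm [measurable]: "g \<in> borel_measurable borel"
    using borel_measurable_has_bochner_integral[OF g] by simp
  have Z: "integrable M (\<lambda>\<omega>. g (Z i \<omega>))" "(LINT \<omega>|M. g (Z i \<omega>)) = v" if "i < N" for i
  proof -
    have d: "distr M lborel (Z i) = std_normal_distribution"
      using dist[OF that] by (rule distributed_distr_eq_density)
    have [measurable]: "Z i \<in> borel_measurable M"
      using distributed_measurable[OF dist[OF that]] by simp
    show "integrable M (\<lambda>\<omega>. g (Z i \<omega>))"
      using g unfolding has_bochner_integral_iff d[symmetric] by (subst (asm) integrable_distr_eq) auto
    show "(LINT \<omega>|M. g (Z i \<omega>)) = v"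
      using g unfolding has_bochner_integral_iff d[symmetric] by (subst (asm) integral_distr) auto
  qed
  have "indep_vars (\<lambda>_. borel) (\<lambda>i \<omega>. g (Z i \<omega>)) {..<N}"
    by (rule indep_vars_compose2[OF indep]) simp
  then show ?thesis
    using indep_vars_integrable[of "{..<N}" "\<lambda>i \<omega>. g (Z i \<omega>)"]
      indep_vars_lebesgue_integral[of "{..<N}" "\<lambda>i \<omega>. g (Z i \<omega>)"] Z
    by (auto simp: has_bochner_integral_iff)
qed

lemma infsum_ennreal_cmult:
  fixes f :: "'a \<Rightarrow> ennreal"
  shows "(\<Sum>\<^sub>\<infinity>x\<in>A. c * f x) = c * (\<Sum>\<^sub>\<infinity>x\<in>A. f x)"
  by (auto simp: nonneg_infsum_complete SUP_mult_left_ennreal simp flip: sum_distrib_left)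

text \<open>Raising the sieve weight to \<open>exp (a x^2)\<close> lets both norms be bounded by the
  same weighted integral.\<close>

lemma grid_L2_norm_sq_le:
  fixes u :: "int \<Rightarrow> real" and g :: "real \<Rightarrow> complex"
  assumes h: "0 < h" and u: "\<And>j. u j = Re (ft g j) / (2 * pi * h)" and K: "0 < K"
    and sieve: "(\<Sum>\<^sub>\<infinity>j::int. ennreal ((norm (ft g j))\<^sup>2))
        \<le> ennreal K * (\<integral>\<^sup>+x. ennreal ((norm (g x))\<^sup>2 * exp (x\<^sup>2 / 2)) \<partial>lborel)"
    and a: "1 / 2 \<le> a"
  shows "grid_L2_norm_sq h u \<le> ennreal (K / (4 * pi\<^sup>2 * h)) * (\<integral>\<^sup>+x. ennreal ((norm (g x))\<^sup>2
      * exp (a * x\<^sup>2)) \<partial>lborel)"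
proof -
  have assoc: "ennreal x * (ennreal y * (ennreal z * I)) = ennreal (x * y * z) * I"
    if "0 \<le> x" "0 \<le> y" "0 \<le> z" for x y z :: real and I
    using that by (simp add: ennreal_mult mult.assoc)
  have uj: "ennreal (\<bar>u j\<bar>\<^sup>2) \<le> ennreal (1 / (2 * pi * h)\<^sup>2) * ennreal ((norm (ft g j))\<^sup>2)" for j
  proof -
    have "(Re (ft g j))\<^sup>2 \<le> (norm (ft g j))\<^sup>2"
      using abs_Re_le_cmod by (simp flip: abs_le_square_iff)
    then show ?thesis
      by (simp add: u power_divide divide_right_mono flip: ennreal_mult)
  qed
  have "grid_L2_norm_sq h u \<le> ennreal h * (\<Sum>\<^sub>\<infinity>j. ennreal (1 / (2 * pi * h)\<^sup>2)
      * ennreal ((norm (ft g j))\<^sup>2))"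
    unfolding grid_L2_norm_sq_def
    by (intro mult_left_mono infsum_mono nonneg_summable_on_complete uj) auto
  also have "(\<Sum>\<^sub>\<infinity>j. ennreal (1 / (2 * pi * h)\<^sup>2) * ennreal ((norm (ft g j))\<^sup>2))
     = ennreal (1 / (2 * pi * h)\<^sup>2) * (\<Sum>\<^sub>\<infinity>j. ennreal ((norm (ft g j))\<^sup>2))"
    by (rule infsum_ennreal_cmult)
  also have "ennreal h * (ennreal (1 / (2 * pi * h)\<^sup>2) * (\<Sum>\<^sub>\<infinity>j. ennreal ((norm (ft g j))\<^sup>2)))
     \<le> ennreal h * (ennreal (1 / (2 * pi * h)\<^sup>2) * (ennreal K * (\<integral>\<^sup>+x. ennreal ((norm (g x))\<^sup>2
         * exp (a * x\<^sup>2)) \<partial>lborel)))"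
  proof (intro mult_left_mono order.trans[OF sieve] nn_integral_mono ennreal_leI)
    fix x :: real
    show "exp (x\<^sup>2 / 2) \<le> exp (a * x\<^sup>2)" using mult_right_mono[OF a, of "x\<^sup>2"] by simp
  qed auto
  also have "\<dots> = ennreal (h * (1 / (2 * pi * h)\<^sup>2) * K) * (\<integral>\<^sup>+x. ennreal ((norm (g x))\<^sup>2 * exp (a
      * x\<^sup>2)) \<partial>lborel)"
    using assoc[of h "1 / (2 * pi * h)\<^sup>2" K] h K by simp
  also have "h * (1 / (2 * pi * h)\<^sup>2) * K = K / (4 * pi\<^sup>2 * h)"
    using h by (simp add: power2_eq_square field_simps)
  finally show ?thesis .
qed

text \<open>Each value is at most the integral of \<open>|g|\<close>; Cauchy-Schwarz against
  \<open>exp (- a x^2 / 2)\<close> gives the weighted integral and the factor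
  \<open>sqrt (pi / a)\<close>.\<close>

lemma grid_Linf_norm_sq_le:
  fixes u :: "int \<Rightarrow> real" and g :: "real \<Rightarrow> complex"
  assumes h: "0 < h" and u: "\<And>j. u j = Re (ft g j) / (2 * pi * h)"
    and g [measurable]: "g \<in> borel_measurable borel" and a: "0 < a"
  shows "grid_Linf_norm_sq u \<le> ennreal (sqrt (pi / a) / (4 * pi\<^sup>2 * h\<^sup>2))
      * (\<integral>\<^sup>+x. ennreal ((norm (g x))\<^sup>2 * exp (a * x\<^sup>2)) \<partial>lborel)"
proof -
  let ?f1 = "\<lambda>x. ennreal (norm (g x) * exp (a * x\<^sup>2 / 2))" and ?f2
      = "\<lambda>x. ennreal (exp (- (a * x\<^sup>2 / 2)))"
  have uj: "ennreal \<bar>u j\<bar> \<le> ennreal (1 / (2 * pi * h)) * (\<integral>\<^sup>+x. norm (g x) \<partial>lborel)" for j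
  proof -
    have "ennreal (norm (ft g j)) \<le> (\<integral>\<^sup>+x. norm (iexp (real_of_int j * x) * g x) \<partial>lborel)"
      unfolding ft_def
    \<comment> \<open>A non-integrable function has integral 0 by convention, so the bound holds in
      that case too.\<close>
    proof (cases "integrable lborel (\<lambda>x. iexp (real_of_int j * x) * g x)")
      case True
      then show "ennreal (norm (CLINT x|lborel. iexp (real_of_int j * x) * g x))
          \<le> (\<integral>\<^sup>+x. norm (iexp (real_of_int j * x) * g x) \<partial>lborel)"
        by (rule integral_norm_bound_ennreal)
    qed (simp add: not_integrable_integral_eq)
    then have *: "ennreal (norm (ft g j)) \<le> (\<integral>\<^sup>+x. norm (g x) \<partial>lborel)" by (simp add: norm_mult)
    have "\<bar>u j\<bar> \<le> 1 / (2 * pi * h) * norm (ft g j)"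
      using h abs_Re_le_cmod[of "ft g j"] by (simp add: u divide_right_mono abs_mult)
    then have "ennreal \<bar>u j\<bar> \<le> ennreal (1 / (2 * pi * h)) * ennreal (norm (ft g j))"
      using h by (simp add: ennreal_leI flip: ennreal_mult)
    also have "\<dots> \<le> ennreal (1 / (2 * pi * h)) * (\<integral>\<^sup>+x. norm (g x) \<partial>lborel)"
      by (intro mult_left_mono *) simp
    finally show ?thesis .
  qed
  have "grid_Linf_norm_sq u \<le> (ennreal (1 / (2 * pi * h)) * (\<integral>\<^sup>+x. norm (g x) \<partial>lborel))\<^sup>2"
    unfolding grid_Linf_norm_sq_def by (intro power_mono SUP_least uj) auto
  also have "\<dots> = ennreal (1 / (4 * pi\<^sup>2 * h\<^sup>2)) * (\<integral>\<^sup>+x. norm (g x) \<partial>lborel)\<^sup>2"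
    using h by (simp add: power_mult_distrib power_divide ennreal_power)
  also have "(\<integral>\<^sup>+x. norm (g x) \<partial>lborel) = (\<integral>\<^sup>+x. ?f1 x * ?f2 x \<partial>lborel)"
    by (intro nn_integral_cong) (simp add: mult.assoc flip: ennreal_mult exp_add)
  also have "(\<integral>\<^sup>+x. ?f1 x * ?f2 x \<partial>lborel)\<^sup>2 \<le> (\<integral>\<^sup>+x. (?f1 x)\<^sup>2 \<partial>lborel) * (\<integral>\<^sup>+x. (?f2 x)\<^sup>2 \<partial>lborel)"
    by (rule Cauchy_Schwarz_nn_integral) simp_all
  also have "(\<integral>\<^sup>+x. (?f1 x)\<^sup>2 \<partial>lborel) = (\<integral>\<^sup>+x. ennreal ((norm (g x))\<^sup>2 * exp (a * x\<^sup>2)) \<partial>lborel)"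
    by (intro nn_integral_cong) (simp add: ennreal_power power_mult_distrib flip: exp_double)
  also have "(\<integral>\<^sup>+x. (?f2 x)\<^sup>2 \<partial>lborel) = (\<integral>\<^sup>+x. ennreal (exp (- (a * x\<^sup>2))) \<partial>lborel)"
    by (intro nn_integral_cong) (simp add: ennreal_power flip: exp_double)
  also have "\<dots> = ennreal (sqrt (pi / a))"
    using gaussian_integral[OF a] by (simp add: has_bochner_integral_iff nn_integral_eq_integral)
  also have "ennreal (1 / (4 * pi\<^sup>2 * h\<^sup>2)) * ((\<integral>\<^sup>+x. ennreal ((norm (g x))\<^sup>2 * exp (a
      * x\<^sup>2)) \<partial>lborel) * ennreal (sqrt (pi / a)))
     = ennreal (1 / (4 * pi\<^sup>2 * h\<^sup>2) * sqrt (pi / a)) * (\<integral>\<^sup>+x. ennreal ((norm (g x))\<^sup>2 * exp (a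
         * x\<^sup>2)) \<partial>lborel)"
    using a by (subst ennreal_mult) (auto simp: mult_ac)
  finally show ?thesis by (simp add: mult_left_mono)
qed

section \<open>The error in Fourier space and its expectation\<close>

context milstein_symbol
begin

text \<open>Only the scheme is confined to the band; the exact product keeps its tails outside, and
  they are part of the error.\<close>

definition fourier_error :: "nat \<Rightarrow> (nat \<Rightarrow> real) \<Rightarrow> real \<Rightarrow> complex" where
  "fourier_error N z x = band (\<lambda>x. \<Prod>i<N. amp x (z i)) x - (\<Prod>i<N. exact x (z i))"

lemma fourier_error_measurable [measurable]:
  assumes [measurable]: "\<And>i. Z i \<in> borel_measurable M"
  shows "(\<lambda>(\<omega>, x). fourier_error N (\<lambda>i. Z i \<omega>) x) \<in> borel_measurable (M \<Otimes>\<^sub>M lborel)"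
  unfolding fourier_error_def band_def amp_def exact_def den_def by measurable

lemma fourier_error_nn_integral_measurable:
  assumes "\<And>i. Z i \<in> borel_measurable M"
  shows "(\<lambda>\<omega>. \<integral>\<^sup>+x. ennreal ((norm (fourier_error N (\<lambda>i. Z i \<omega>) x))\<^sup>2 * exp (a
      * x\<^sup>2)) \<partial>lborel) \<in> borel_measurable M"
proof -
  have [measurable]: "(\<lambda>p. fourier_error N (\<lambda>i. Z i (fst p)) (snd p)) \<in> borel_measurable (M \<Otimes>\<^sub>M lborel)"
    using fourier_error_measurable[OF assms] by (simp add: case_prod_beta')
  show ?thesis
    by (rule lborel.borel_measurable_nn_integral) (unfold case_prod_beta', measurable)
qed

text \<open>The phases add up, so only the sum of the increments remains, as the solution depends on
  the path only through its final value.\<close>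

lemma exact_prod: "(\<Prod>i<N. exact x (z i)) =
    iexp (- (sqrt (r * l) * (\<Sum>i<N. z i)) * x) * of_real (exp (- ((1 - r) * l * real N / 2 * x\<^sup>2)))"
proof -
  have "(\<Prod>i<N. exact x (z i)) = of_real (exp (- ((1 - r) * l * x\<^sup>2 / 2))) ^ N
      * (\<Prod>i<N. iexp (- (sqrt (r * l) * x * z i)))"
    by (simp add: exact_def prod.distrib)
  also have "(\<Prod>i<N. iexp (- (sqrt (r * l) * x * z i))) = iexp (- (sqrt (r * l) * (\<Sum>i<N. z i)) * x)"
    by (simp add: sum_distrib_left sum_negf mult_ac flip: exp_sum)
  also have "complex_of_real (exp (- ((1 - r) * l * x\<^sup>2 / 2))) ^ N
      = of_real (exp (- ((1 - r) * l * real N / 2 * x\<^sup>2)))"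
    unfolding of_real_power[symmetric] exp_of_nat_mult[symmetric] by (simp add: mult_ac)
  finally show ?thesis by (simp add: mult.commute)
qed

lemma scheme_error_fourier:
  assumes V: "milstein_scheme r \<theta> \<sigma> k h N z V" and t: "t = \<theta> - r * \<sigma>"
    and N: "0 < N" and k: "0 < k" and h: "h = sqrt (k / l)" and m: "m = sqrt k * (\<Sum>i<N. z i)"
  shows "V N j - spde_solution r m (real N * k) (real_of_int j * h)
      = Re (ft (fourier_error N z) j) / (2 * pi * h)"
proof -
  define E where "E x = (\<Prod>i<N. exact x (z i))" for x
  have h0: "0 < h" using h k l by simp
  have "sqrt (r * l) * (\<Sum>i<N. z i) = sqrt r * m / h"
    using k l by (simp add: m h real_sqrt_mult real_sqrt_divide)
  then have E: "E = (\<lambda>x. iexp (- (sqrt r * m / h) * x) * of_real (exp (- ((1 - r) * l * real N / 2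
      * x\<^sup>2))))"
    unfolding E_def exact_prod by simp
  note s = spde_solution_fourier[OF N k h, where j = j and m = m, folded E]
  have s1: "integrable lborel (\<lambda>x. iexp (real_of_int j * x) * E x)"
    using s(1) unfolding E by simp
  have s2: "spde_solution r m (real N * k) (real_of_int j * h) = Re (ft E j) / (2 * pi * h)"
    using s(2) unfolding E by simp
  have "ft (fourier_error N z) j = ft (band (\<lambda>x. \<Prod>i<N. amp x (z i))) j - ft E j"
    unfolding ft_def fourier_error_def E_def[symmetric] right_diff_distrib
    by (intro Bochner_Integration.integral_diff band_integrable continuous_amp_prod s1)
  then show ?thesis
    unfolding milstein_scheme_fourier[OF V t k h order_refl] s2 by (simp add: diff_divide_distrib)
qed

lemma symbol_error_expectation:
  assumes "prob_space M" and indep: "prob_space.indep_vars M (\<lambda>_. borel) Z {..<N}"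
    and dist: "\<And>i. i < N \<Longrightarrow> distributed M lborel (Z i) std_normal_density"
  shows "(\<integral>\<^sup>+\<omega>. ennreal ((norm ((\<Prod>i<N. amp x (Z i \<omega>)) - (\<Prod>i<N. exact x (Z i \<omega>))))\<^sup>2) \<partial>M)
     = ennreal (mean_sq_amp x ^ N - 2 * mean_cross x ^ N + sq_exact x ^ N)"
proof -
  interpret prob_space M by fact
  have 1: "has_bochner_integral M (\<lambda>\<omega>. \<Prod>i<N. (norm (amp x (Z i \<omega>)))\<^sup>2) (mean_sq_amp x ^ N)"
    using norm_amp_integral by (intro indep_std_normal_prod indep dist) (auto simp:
        has_bochner_integral_iff)
  have "has_bochner_integral M (\<lambda>\<omega>. \<Prod>i<N. cnj (amp x (Z i \<omega>))
      * exact x (Z i \<omega>)) (of_real (mean_cross x) ^ N)"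
    using cnj_amp_exact_integral by (intro indep_std_normal_prod indep dist) (auto simp:
        has_bochner_integral_iff)
  from has_bochner_integral_Re[OF this]
  have 2: "has_bochner_integral M (\<lambda>\<omega>. Re (\<Prod>i<N. cnj (amp x (Z i \<omega>))
      * exact x (Z i \<omega>))) (mean_cross x ^ N)"
    by (simp flip: of_real_power)
  have 3: "has_bochner_integral M (\<lambda>\<omega>. sq_exact x ^ N) (sq_exact x ^ N)"
    by (simp add: has_bochner_integral_iff prob_space)
  have "has_bochner_integral M (\<lambda>\<omega>. (\<Prod>i<N. (norm (amp x (Z i \<omega>)))\<^sup>2) - 2
      * Re (\<Prod>i<N. cnj (amp x (Z i \<omega>)) * exact x (Z i \<omega>)) + sq_exact x ^ N)
     (mean_sq_amp x ^ N - 2 * mean_cross x ^ N + sq_exact x ^ N)"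
    by (intro has_bochner_integral_add has_bochner_integral_diff has_bochner_integral_mult_right 1 2 3)
  also have "(\<lambda>\<omega>. (\<Prod>i<N. (norm (amp x (Z i \<omega>)))\<^sup>2) - 2 * Re (\<Prod>i<N. cnj (amp x (Z i \<omega>))
      * exact x (Z i \<omega>)) + sq_exact x ^ N)
     = (\<lambda>\<omega>. (norm ((\<Prod>i<N. amp x (Z i \<omega>)) - (\<Prod>i<N. exact x (Z i \<omega>))))\<^sup>2)"
  proof
    fix \<omega>
    define a b where "a = (\<Prod>i<N. amp x (Z i \<omega>))" and "b = (\<Prod>i<N. exact x (Z i \<omega>))"
    have "(norm (a - b))\<^sup>2 = (norm a)\<^sup>2 - 2 * Re (cnj a * b) + (norm b)\<^sup>2"
      unfolding cmod_power2 by (simp add: power2_eq_square algebra_simps)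
    moreover have "(norm a)\<^sup>2 = (\<Prod>i<N. (norm (amp x (Z i \<omega>)))\<^sup>2)"
        by (simp add: a_def prod_norm[symmetric] prod_power_distrib)
    moreover have "(norm b)\<^sup>2 = sq_exact x ^ N"
      by (simp add: b_def prod_norm[symmetric] prod_power_distrib norm_exact)
    moreover have "cnj a * b = (\<Prod>i<N. cnj (amp x (Z i \<omega>)) * exact x (Z i \<omega>))"
      by (simp add: a_def b_def prod.distrib)
    ultimately show "(\<Prod>i<N. (norm (amp x (Z i \<omega>)))\<^sup>2) - 2 * Re (\<Prod>i<N. cnj (amp x (Z i \<omega>))
        * exact x (Z i \<omega>)) + sq_exact x ^ N
       = (norm (a - b))\<^sup>2" by simp
  qed
  finally show ?thesis by (simp add: has_bochner_integral_iff nn_integral_eq_integral)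
qed

lemma weighted_error_expectation:
  obtains K d where "0 < K" "0 < d"
    "\<And>(M :: 'a measure) Z N. prob_space M \<Longrightarrow> prob_space.indep_vars M (\<lambda>_. borel) Z {..<N} \<Longrightarrow>
      (\<And>i. i < N \<Longrightarrow> distributed M lborel (Z i) std_normal_density) \<Longrightarrow>
      (\<And>i. Z i \<in> borel_measurable M) \<Longrightarrow> 2 \<le> N \<Longrightarrow>
      (\<integral>\<^sup>+\<omega>. \<integral>\<^sup>+x. ennreal ((norm (fourier_error N (\<lambda>i. Z i \<omega>) x))\<^sup>2 * exp (d * real N
          * x\<^sup>2)) \<partial>lborel \<partial>M)
        \<le> ennreal (K / (real N)\<^sup>2 * sqrt (pi / (d * real N)))"
proof -
  obtain K0 c where K0: "0 < K0" and c: "0 < c" "c \<le> (1 - r) * l / 4"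
    and pw: "\<And>N x. 2 \<le> N \<Longrightarrow> \<bar>x\<bar> \<le> pi \<Longrightarrow>
       mean_sq_amp x ^ N - 2 * mean_cross x ^ N + sq_exact x ^ N
           \<le> K0 / (real N)\<^sup>2 * exp (- c * real N * x\<^sup>2)"
    using moments_power_bound by blast
  obtain K1 where K1: "0 < K1" "\<And>y. 0 \<le> y \<Longrightarrow> y\<^sup>2 \<le> K1 * exp (c * y)"
    using power_le_exp[OF c(1)] by blast
  show ?thesis
  proof
    show "0 < K0 + K1" using K0 K1 by simp
    \<comment> \<open>The weight spends half of the decay rate \<open>c\<close>, which leaves a
      Gaussian of rate \<open>c / 2\<close> per time step for the integral over
      \<open>x\<close>.\<close>
    show "0 < c / 2" using c by simp
    fix M :: "'a measure" and Z :: "nat \<Rightarrow> 'a \<Rightarrow> real" and N :: nat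
    assume M: "prob_space M" and indep: "prob_space.indep_vars M (\<lambda>_. borel) Z {..<N}"
      and dist: "\<And>i. i < N \<Longrightarrow> distributed M lborel (Z i) std_normal_density"
      and Z [measurable]: "\<And>i. Z i \<in> borel_measurable M" and N: "2 \<le> N"
    interpret prob_space M by fact
    interpret pair_sigma_finite M lborel ..
    let ?g = "\<lambda>\<omega>. fourier_error N (\<lambda>i. Z i \<omega>)"
    have pt: "(\<integral>\<^sup>+\<omega>. ennreal ((norm (?g \<omega> x))\<^sup>2) \<partial>M) \<le> ennreal ((K0 + K1) / (real N)\<^sup>2 * exp (- c
        * real N * x\<^sup>2))" for x
    proof (cases "\<bar>x\<bar> \<le> pi")
      case True
      then have "(\<integral>\<^sup>+\<omega>. ennreal ((norm (?g \<omega> x))\<^sup>2) \<partial>M) = ennreal (mean_sq_amp x ^ N - 2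
          * mean_cross x ^ N + sq_exact x ^ N)"
        by (subst symbol_error_expectation[OF M indep dist, symmetric])
          (auto simp: fourier_error_def band_def abs_le_iff intro!: nn_integral_cong)
      also have "\<dots> \<le> ennreal ((K0 + K1) / (real N)\<^sup>2 * exp (- c * real N * x\<^sup>2))"
      proof (intro ennreal_leI order.trans[OF pw[OF N True]] mult_right_mono divide_right_mono)
      qed (use K1 in auto)
      finally show ?thesis .
    next
      case False
      \<comment> \<open>Outside the band only the exact product survives, with decay rate at least
        \<open>2 c\<close>. As \<open>x^2 >= 1\<close>, one \<open>c\<close> yields the factor
        \<open>K1 / N^2\<close>; the other remains as the Gaussian.\<close>
      have "x\<^sup>2 \<ge> 1" using False pi_gt3 by (simp flip: abs_le_square_iff add: abs_le_square_iff[of 1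
          x, simplified, symmetric])
      then have "c * real N * 1 \<le> c * real N * x\<^sup>2" using c by (intro mult_left_mono) auto
      then have "(real N)\<^sup>2 * exp (- (c * real N * x\<^sup>2))
          \<le> (K1 * exp (c * real N)) * exp (- (c * real N))"
        using K1(1) K1(2)[of "real N"] by (intro mult_mono) auto
      then have e: "exp (- (c * real N * x\<^sup>2)) \<le> K1 / (real N)\<^sup>2"
        using N by (simp add: exp_minus field_simps)
      have "(norm (?g \<omega> x))\<^sup>2 \<le> (K0 + K1) / (real N)\<^sup>2 * exp (- c * real N * x\<^sup>2)" for \<omega>
      proof -
        have "x \<notin> {-pi..pi}" using False by (auto simp: abs_le_iff)
        then have "(norm (?g \<omega> x))\<^sup>2 = sq_exact x ^ N"
          by (simp add: fourier_error_def band_def prod_norm[symmetric] prod_power_distrib norm_exact)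
        also have "\<dots> = exp (- (real N * x\<^sup>2 * ((1 - r) * l)))"
          by (simp add: sq_exact_def mult_ac flip: exp_of_nat_mult)
        also have "\<dots> \<le> exp (- (real N * x\<^sup>2 * (2 * c)))"
          using c by (simp add: mult_left_mono)
        also have "\<dots> = exp (- (c * real N * x\<^sup>2)) * exp (- c * real N * x\<^sup>2)"
          by (simp add: mult_ac flip: exp_add)
        also have "\<dots> \<le> (K0 + K1) / (real N)\<^sup>2 * exp (- c * real N * x\<^sup>2)"
          using K0 by (intro mult_right_mono order.trans[OF e] divide_right_mono) auto
        finally show ?thesis .
      qed
      then have "(\<integral>\<^sup>+\<omega>. ennreal ((norm (?g \<omega> x))\<^sup>2) \<partial>M) \<le> (\<integral>\<^sup>+\<omega>. ennreal ((K0 + K1) / (real N)\<^sup>2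
          * exp (- c * real N * x\<^sup>2)) \<partial>M)"
        by (intro nn_integral_mono ennreal_leI)
      then show ?thesis by (simp add: emeasure_space_1)
    qed
    have "(\<integral>\<^sup>+\<omega>. \<integral>\<^sup>+x. ennreal ((norm (?g \<omega> x))\<^sup>2 * exp (c / 2 * real N * x\<^sup>2)) \<partial>lborel \<partial>M)
      = (\<integral>\<^sup>+x. \<integral>\<^sup>+\<omega>. ennreal ((norm (?g \<omega> x))\<^sup>2 * exp (c / 2 * real N * x\<^sup>2)) \<partial>M \<partial>lborel)"
    proof (rule Fubini'[symmetric])
      have [measurable]: "(\<lambda>p. ?g (fst p) (snd p)) \<in> borel_measurable (M \<Otimes>\<^sub>M lborel)"
        using fourier_error_measurable[OF Z] by (simp add: case_prod_beta')
      show "(\<lambda>(\<omega>, x). ennreal ((norm (?g \<omega> x))\<^sup>2 * exp (c / 2 * real N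
          * x\<^sup>2))) \<in> borel_measurable (M \<Otimes>\<^sub>M lborel)"
        unfolding case_prod_beta' by measurable
    qed
    also have "\<dots> \<le> (\<integral>\<^sup>+x. ennreal ((K0 + K1) / (real N)\<^sup>2) * ennreal (exp (- (c / 2 * real N
        * x\<^sup>2))) \<partial>lborel)"
    proof (rule nn_integral_mono)
      fix x :: real
      have [measurable]: "(\<lambda>\<omega>. ?g \<omega> x) \<in> borel_measurable M"
        using measurable_compose_Pair1[OF _ fourier_error_measurable[OF Z]]
          measurable_compose[OF measurable_Pair2'[of x lborel M] fourier_error_measurable[OF Z, of
              N]] by simp
      have "(\<integral>\<^sup>+\<omega>. ennreal ((norm (?g \<omega> x))\<^sup>2 * exp (c / 2 * real N * x\<^sup>2)) \<partial>M)
         = (\<integral>\<^sup>+\<omega>. ennreal ((norm (?g \<omega> x))\<^sup>2) \<partial>M) * ennreal (exp (c / 2 * real N * x\<^sup>2))"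
        by (simp add: ennreal_mult nn_integral_multc)
      also have "\<dots> \<le> ennreal ((K0 + K1) / (real N)\<^sup>2 * exp (- c * real N * x\<^sup>2))
          * ennreal (exp (c / 2 * real N * x\<^sup>2))"
        by (intro mult_right_mono pt) simp
      also have "\<dots> = ennreal ((K0 + K1) / (real N)\<^sup>2) * ennreal (exp (- (c / 2 * real N * x\<^sup>2)))"
        using K0 K1 by (simp add: mult.assoc flip: ennreal_mult exp_add)
      finally show "(\<integral>\<^sup>+\<omega>. ennreal ((norm (?g \<omega> x))\<^sup>2 * exp (c / 2 * real N * x\<^sup>2)) \<partial>M)
         \<le> ennreal ((K0 + K1) / (real N)\<^sup>2) * ennreal (exp (- (c / 2 * real N * x\<^sup>2)))" .
    qed
    also have "\<dots> = ennreal ((K0 + K1) / (real N)\<^sup>2) * ennreal (sqrt (pi / (c / 2 * real N)))"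
      using gaussian_integral[of "c / 2 * real N"] c N
      by (subst nn_integral_cmult) (auto simp: has_bochner_integral_iff nn_integral_eq_integral)
    also have "\<dots> = ennreal ((K0 + K1) / (real N)\<^sup>2 * sqrt (pi / (c / 2 * real N)))"
      using K0 K1(1) c by (subst ennreal_mult[symmetric]) auto
    finally show "(\<integral>\<^sup>+\<omega>. \<integral>\<^sup>+x. ennreal ((norm (?g \<omega> x))\<^sup>2 * exp (c / 2 * real N * x\<^sup>2)) \<partial>lborel \<partial>M)
        \<le> ennreal ((K0 + K1) / (real N)\<^sup>2 * sqrt (pi / (c / 2 * real N)))" .
  qed
qed

end

section \<open>From mean squares of order \<open>1 / N^2\<close> to the rate\<close>

lemma root_mean_square_rate:
  fixes ms :: "nat \<Rightarrow> ennreal"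
  assumes C: "0 \<le> C" and T: "0 < T" and ms: "\<And>N. N0 \<le> N \<Longrightarrow> ms N \<le> ennreal (C / (real N)\<^sup>2)"
    and k: "\<And>N. k N = T / real N"
  shows "(\<forall>\<^sub>F N in sequentially. ms N < \<infinity>) \<and> (\<lambda>N. sqrt (enn2real (ms N))) \<longlonglongrightarrow> 0 \<and>
    (\<lambda>N. sqrt (enn2real (ms N))) \<in> O(k)"
proof -
  have le: "sqrt (enn2real (ms N)) \<le> sqrt C / T * k N" if N: "N0 \<le> N" for N
  proof -
    have "enn2real (ms N) \<le> C / (real N)\<^sup>2"
      using enn2real_mono[OF ms[OF N]] C by simp
    then have "sqrt (enn2real (ms N)) \<le> sqrt (C / (real N)\<^sup>2)" by simp
    then show ?thesis using T by (simp add: real_sqrt_divide k)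
  qed
  have "\<forall>\<^sub>F N in sequentially. ms N < \<infinity>"
    using le_less_trans[OF ms ennreal_less_top] by (intro eventually_sequentiallyI[of N0]) simp
  moreover have "(\<lambda>N. sqrt (enn2real (ms N))) \<in> O(k)"
  proof (rule bigoI)
    show "\<forall>\<^sub>F N in sequentially. norm (sqrt (enn2real (ms N))) \<le> sqrt C / T * norm (k N)"
      using le T by (intro eventually_sequentiallyI[of N0]) (simp add: k)
  qed
  moreover have "(\<lambda>N. sqrt (enn2real (ms N))) \<longlonglongrightarrow> 0"
  proof (rule tendsto_sandwich[where f = "\<lambda>_. 0" and h = "\<lambda>N. sqrt C / T * k N"])
    show "\<forall>\<^sub>F N in sequentially. sqrt (enn2real (ms N)) \<le> sqrt C / T * k N"
      using le by (rule eventually_sequentiallyI)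
    have "(\<lambda>N. sqrt C / T * (T / real N)) \<longlonglongrightarrow> sqrt C / T * 0"
      by (intro tendsto_mult tendsto_const lim_const_over_n)
    then show "(\<lambda>N. sqrt C / T * k N) \<longlonglongrightarrow> 0" by (simp add: k)
  qed auto
  ultimately show ?thesis by blast
qed

section \<open>Normalised Brownian increments\<close>

lemma (in standard_brownian_motion) normalized_increment_distributed:
  assumes k: "0 < k"
  shows "distributed M lborel (\<lambda>\<omega>. normalized_increment B k \<omega> i) std_normal_density"
proof -
  have "distributed M lborel (\<lambda>\<omega>. B (real (Suc i) * k) \<omega> - B (real i * k) \<omega>)
     (normal_density 0 (sqrt (real (Suc i) * k - real i * k)))"
    using k by (intro BM_normal_increments) auto
  also have "real (Suc i) * k - real i * k = k" by (simp add: algebra_simps)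
  finally show ?thesis
    using k by (subst (asm) normal_standard_normal_convert) (auto simp: normalized_increment_def)
qed

lemma (in standard_brownian_motion) normalized_increment_indep:
  assumes k: "0 < k"
  shows "indep_vars (\<lambda>_. borel) (\<lambda>i \<omega>. normalized_increment B k \<omega> i) {..<N}"
proof -
  have "indep_vars (\<lambda>_. borel) (\<lambda>i \<omega>. B (real (Suc i) * k) \<omega> - B (real i * k) \<omega>) {..<N}"
    using k by (intro BM_indep_increments) auto
  then show ?thesis
    unfolding normalized_increment_def by (rule indep_vars_compose2) simp
qed

lemma (in standard_brownian_motion) normalized_increment_measurable:
  "0 < k \<Longrightarrow> (\<lambda>\<omega>. normalized_increment B k \<omega> i) \<in> borel_measurable M"
  using BM_measurable[of "real (Suc i) * k"] BM_measurable[of "real i * k"]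
  unfolding normalized_increment_def by simp

text \<open>The increments telescope; the equality is only almost sure because
  \<open>B 0 = 0\<close> is.\<close>

lemma (in standard_brownian_motion) normalized_increment_sum:
  assumes k: "0 < k"
  shows "AE \<omega> in M. B (real N * k) \<omega> = sqrt k * (\<Sum>i<N. normalized_increment B k \<omega> i)"
  using BM_zero
proof eventually_elim
  fix \<omega> assume "B 0 \<omega> = 0"
  moreover have "(\<Sum>i<N. B (real (Suc i) * k) \<omega> - B (real i * k) \<omega>)
      = B (real N * k) \<omega> - B (real 0 * k) \<omega>"
    by (rule sum_lessThan_telescope)
  ultimately show "B (real N * k) \<omega> = sqrt k * (\<Sum>i<N. normalized_increment B k \<omega> i)"
    using k by (simp add: normalized_increment_def flip: sum_divide_distrib)
qed

theorem corollary2p1: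
  fixes M :: "'a measure"
    and B :: "real \<Rightarrow> 'a \<Rightarrow> real"
    and \<rho> \<theta> \<sigma> T lam :: real
    and k h :: "nat \<Rightarrow> real"
    and V :: "nat \<Rightarrow> 'a \<Rightarrow> nat \<Rightarrow> int \<Rightarrow> real"
    and err :: "nat \<Rightarrow> 'a \<Rightarrow> int \<Rightarrow> real"
  assumes "0 \<le> \<rho>" and "\<rho> < 1" and "0 \<le> \<theta>" and "\<theta> \<le> 1" and "0 < T" and "0 < lam"
    and "lam * (1 - 2 * (\<theta> - \<rho> * \<sigma> - \<rho>\<^sup>2)) < 1"
    and "standard_brownian_motion M B"
    and "\<And>N. k N = T / real N"
    and "\<And>N. h N = sqrt (k N / lam)"
    and "\<And>N \<omega>. 1 \<le> N \<Longrightarrow> \<omega> \<in> space M \<Longrightarrow>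
           milstein_scheme \<rho> \<theta> \<sigma> (k N) (h N) N (normalized_increment B (k N) \<omega>) (V N \<omega>)"
    and "\<And>N \<omega> j. err N \<omega> j = V N \<omega> N j - spde_solution \<rho> (B T \<omega>) T (real_of_int j * h N)"
  shows "\<forall>norm_sq \<in> {\<lambda>N. grid_L2_norm_sq (h N), \<lambda>N. grid_Linf_norm_sq}.
           (\<forall>\<^sub>F N in sequentially. mean_square M (norm_sq N) (err N) < \<infinity>) \<and>
           (\<lambda>N. root_mean_square M (norm_sq N) (err N)) \<longlonglongrightarrow> 0 \<and>
           (\<lambda>N. root_mean_square M (norm_sq N) (err N)) \<in> O(k)"
proof -
  note T = \<open>0 < T\<close> and lam = \<open>0 < lam\<close> and k = assms(9) and h = assms(10)
    and V = assms(11) and err = assms(12)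
  interpret standard_brownian_motion M B by fact
  interpret milstein_symbol lam \<rho> "\<theta> - \<rho> * \<sigma>" using assms by unfold_locales auto
  obtain K d where K: "0 < K" and d: "0 < d" and Kd:
    "\<And>(M :: 'a measure) Z N. prob_space M \<Longrightarrow> prob_space.indep_vars M (\<lambda>_. borel) Z {..<N} \<Longrightarrow>
      (\<And>i. i < N \<Longrightarrow> distributed M lborel (Z i) std_normal_density) \<Longrightarrow>
      (\<And>i. Z i \<in> borel_measurable M) \<Longrightarrow> 2 \<le> N \<Longrightarrow>
      (\<integral>\<^sup>+\<omega>. \<integral>\<^sup>+x. ennreal ((norm (fourier_error N (\<lambda>i. Z i \<omega>) x))\<^sup>2 * exp (d * real N
          * x\<^sup>2)) \<partial>lborel \<partial>M)
        \<le> ennreal (K / (real N)\<^sup>2 * sqrt (pi / (d * real N)))"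
    using weighted_error_expectation by blast
  obtain L :: real where L: "0 < L"
    "\<And>g :: real \<Rightarrow> complex. g \<in> borel_measurable borel \<Longrightarrow>
      (\<Sum>\<^sub>\<infinity>j::int. ennreal ((norm (ft g j))\<^sup>2)) \<le> ennreal L * (\<integral>\<^sup>+x. ennreal ((norm (g x))\<^sup>2
          * exp (x\<^sup>2 / 2)) \<partial>lborel)"
    using gaussian_sieve unfolding ft_def by blast
  \<comment> \<open>\<open>N >= 2\<close> is for the power estimate, and \<open>d N >= 1 / 2\<close>
    makes the weight \<open>exp (d N x^2)\<close> dominate that of the sieve.\<close>
  define N0 where "N0 = max 2 (nat \<lceil>1 / (2 * d)\<rceil>)"
  define J where "J N \<omega> = (\<integral>\<^sup>+x. ennreal ((norm (fourier_error N (normalized_increment B (k N) \<omega>) x))\<^sup>2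
      * exp (d * real N * x\<^sup>2)) \<partial>lborel)" for N \<omega>
  \<comment> \<open>Common to both norms: \<open>nsq\<close> is any squared norm controlled by the
    weighted integral, with a prefactor \<open>c\<close> that may depend on
    \<open>N\<close>.\<close>
  have main: "mean_square M nsq (err N) \<le> ennreal (c * (K / (real N)\<^sup>2 * sqrt (pi / (d * real N))))"
    if N: "N0 \<le> N" and c: "0 \<le> c" and nsq: "\<And>u g. g \<in> borel_measurable borel \<Longrightarrow> (\<And>j. u j
        = Re (ft g j) / (2 * pi * h N)) \<Longrightarrow>
      nsq u \<le> ennreal c * (\<integral>\<^sup>+x. ennreal ((norm (g x))\<^sup>2 * exp (d * real N * x\<^sup>2)) \<partial>lborel)"
    for N nsq c
  proof -
    have N2: "2 \<le> N" using N by (simp add: N0_def)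
    then have kN: "0 < k N" and NkT: "real N * k N = T" using T by (simp_all add: k)
    note Z = normalized_increment_measurable[OF kN]
    have "AE \<omega> in M. nsq (err N \<omega>) \<le> ennreal c * J N \<omega>"
      using normalized_increment_sum[OF kN, of N] AE_space
    proof eventually_elim
      fix \<omega> assume m: "B (real N * k N) \<omega> = sqrt (k N) * (\<Sum>i<N. normalized_increment B (k N) \<omega> i)"
        and \<omega>: "\<omega> \<in> space M"
      show "nsq (err N \<omega>) \<le> ennreal c * J N \<omega>"
        unfolding J_def
      proof (rule nsq)
        show "err N \<omega> j = Re (ft (fourier_error N (normalized_increment B (k N) \<omega>)) j) / (2 * pi
            * h N)" for j
          using scheme_error_fourier[OF V[OF _ \<omega>] refl _ kN h m, of j] N2
          unfolding err NkT by simp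
        show "fourier_error N (normalized_increment B (k N) \<omega>) \<in> borel_measurable borel"
          unfolding fourier_error_def[abs_def] band_def amp_def exact_def den_def by measurable
      qed
    qed
    \<comment> \<open>Monotonicity of the integral asks for no measurability of the error; only
      \<open>J N\<close> has to be measurable, to pull out the constant.\<close>
    then have "mean_square M nsq (err N) \<le> (\<integral>\<^sup>+\<omega>. ennreal c * J N \<omega> \<partial>M)"
      unfolding mean_square_def by (rule nn_integral_mono_AE)
    also have "\<dots> = ennreal c * (\<integral>\<^sup>+\<omega>. J N \<omega> \<partial>M)"
      unfolding J_def by (intro nn_integral_cmult fourier_error_nn_integral_measurable Z)
    also have "\<dots> \<le> ennreal c * ennreal (K / (real N)\<^sup>2 * sqrt (pi / (d * real N)))"
      unfolding J_def using N2
      by (intro mult_left_mono Kd prob_space_axioms normalized_increment_indep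
          normalized_increment_distributed kN Z) auto
    finally show ?thesis using c K d by (subst ennreal_mult) auto
  qed
  have N0: "0 < N" "1 / 2 \<le> d * real N" "0 < h N" "(h N)\<^sup>2 = T / (real N * lam)" if "N0 \<le> N" for N
  proof -
    show N: "0 < N" using that by (simp add: N0_def)
    have "1 / (2 * d) \<le> real N" using that unfolding N0_def by linarith
    then show "1 / 2 \<le> d * real N" using d by (simp add: field_simps)
    show "0 < h N" "(h N)\<^sup>2 = T / (real N * lam)" using N T lam by (simp_all add: h k)
  qed
  have 2: "mean_square M (grid_L2_norm_sq (h N)) (err N)
      \<le> ennreal (L * K / (4 * pi\<^sup>2) * sqrt (pi * lam / (d * T)) / (real N)\<^sup>2)"
    if N: "N0 \<le> N" for N
  proof -
    \<comment> \<open>The factor from the Gaussian integral is proportional to \<open>h N\<close>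
      and cancels the \<open>1 / h\<close> in front of the L2 bound.\<close>
    have "sqrt (pi / (d * real N)) = sqrt (pi * lam / (d * T)) * h N"
    proof -
      have "pi / (d * real N) = pi * lam / (d * T) * (k N / lam)"
        using N0(1)[OF N] T lam d by (simp add: k field_simps)
      then show ?thesis unfolding h by (metis real_sqrt_mult)
    qed
    then have "L / (4 * pi\<^sup>2 * h N) * (K / (real N)\<^sup>2 * sqrt (pi / (d * real N)))
        = L * K / (4 * pi\<^sup>2) * sqrt (pi * lam / (d * T)) / (real N)\<^sup>2"
      using N0(3)[OF N] by simp
    moreover have "mean_square M (grid_L2_norm_sq (h N)) (err N)
       \<le> ennreal (L / (4 * pi\<^sup>2 * h N) * (K / (real N)\<^sup>2 * sqrt (pi / (d * real N))))"
      using L N0[OF N] by (intro main N grid_L2_norm_sq_le L) auto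
    ultimately show ?thesis by simp
  qed
  have Inf: "mean_square M grid_Linf_norm_sq (err N) \<le> ennreal (K * lam / (4 * pi * d
      * T) / (real N)\<^sup>2)"
    if N: "N0 \<le> N" for N
  proof -
    \<comment> \<open>The square roots from Cauchy-Schwarz and from the Gaussian integral multiply
      to \<open>pi / (d N)\<close>, which balances \<open>1 / h^2 = N lam / T\<close>.\<close>
    have "s / q * (p * s) = s\<^sup>2 / q * p" for p q s :: real by (simp add: power2_eq_square)
    then have "sqrt (pi / (d * real N)) / (4 * pi\<^sup>2 * (h N)\<^sup>2) * (K / (real N)\<^sup>2 * sqrt (pi / (d
        * real N)))
      = (sqrt (pi / (d * real N)))\<^sup>2 / (4 * pi\<^sup>2 * (h N)\<^sup>2) * (K / (real N)\<^sup>2)" .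
    also have "(sqrt (pi / (d * real N)))\<^sup>2 = pi / (d * real N)" using d by simp
    also have "pi / (d * real N) / (4 * pi\<^sup>2 * (h N)\<^sup>2) * (K / (real N)\<^sup>2)
        = K * lam / (4 * pi * d * T) / (real N)\<^sup>2"
      using N0(1)[OF N] T lam d unfolding N0(4)[OF N] by (simp add: field_simps power2_eq_square)
    finally have eq: "sqrt (pi / (d * real N)) / (4 * pi\<^sup>2 * (h N)\<^sup>2) * (K / (real N)\<^sup>2
        * sqrt (pi / (d * real N)))
      = K * lam / (4 * pi * d * T) / (real N)\<^sup>2" .
    show ?thesis
      unfolding eq[symmetric] using d T lam N0[OF N] by (intro main N grid_Linf_norm_sq_le) auto
  qed
  have "0 \<le> L * K / (4 * pi\<^sup>2) * sqrt (pi * lam / (d * T))" "0 \<le> K * lam / (4 * pi * d * T)"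
    using L K d T lam by auto
  from root_mean_square_rate[OF this(1) T 2 k] root_mean_square_rate[OF this(2) T Inf k]
  show ?thesis unfolding root_mean_square_def by simp
qed

end
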